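(* Let $A$ be a closed, densely defined $G$-symmetric operator in $\mathcal H$. Let $[a,b]\subset\mathbb R$ be a compact interval with $[a,b]\cap\sigma_{ap}(A)\subset\sigma_{\pi_+}(A)$ or $[a,b]\cap\sigma_{ap}(A)\subset\sigma_{\pi_-}(A)$, and suppose that there is an open neighborhood $\mathcal U$ of $[a,b]$ in $\mathbb C$ with $\mathcal U\setminus\mathbb R\subset\rho(A)$. Then there exist an open neighborhood $\mathcal V$ of $[a,b]$ in $\mathbb C$ and constants $M>0$ and $m\in\mathbb N$ such that for all $\lambda\in\mathcal V\setminus\mathbb R$ we have $$\|(A-\lambda)^{-1}\|\le\frac{M}{|\operatorname{Im}\lambda|^m}.$$
   Context: $(\mathcal H,(\cdot,\cdot))$ is a Hilbert space, $G$ is a bounded selfadjoint operator in $\mathcal H$ (not assumed boundedly invertible or injective), and $[x,y]:=(Gx,y)$. A linear operator $A$ in $\mathcal H$ is $G$-symmetric if $[Ax,y]=[x,Ay]$ for all $x,y\in\operatorname{dom}A$. For a closed, densely defined operator $A$, $\sigma_{ap}(A)$ is the set of all $\lambda\in\mathbb C$ for which there is a sequence $(x_n)$ in $\operatorname{dom}A$ with $\|x_n\|=1$ and $(A-\lambda)x_n\to0$. A point $\lambda\in\sigma_{ap}(A)$ belongs to $\sigma_{\pi_+}(A)$ (resp. $\sigma_{\pi_-}(A)$) if there is a linear manifold $\mathcal H_\lambda\subset\mathcal H$ with $\dim(\mathcal H/\mathcal H_\lambda)<\infty$ such that for every sequence $(x_n)$ in $\mathcal H_\lambda\cap\operatorname{dom}A$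 with $\|x_n\|=1$ and $(A-\lambda)x_n\to0$ one has $\liminf_n[x_n,x_n]>0$ (resp. $\limsup_n[x_n,x_n]<0$). *)

theory Defs
  imports "HOL-Analysis.Analysis"
begin

text \<open>Complex Hilbert spaces. The inner product is linear in its first argument. The real normed
  structure inherited from \<^class>\<open>banach\<close> is tied to the complex one by the assumptions
  \<open>scaleC_of_real\<close> and \<open>cinner_same\<close>; the latter contains positive definiteness.\<close>

class chilbert_space = banach +
  fixes scaleC :: "complex \<Rightarrow> 'a \<Rightarrow> 'a" (infixr "*\<^sub>C" 75)
    and cinner :: "'a \<Rightarrow> 'a \<Rightarrow> complex"
  assumes scaleC_add_right: "c *\<^sub>C (x + y) = c *\<^sub>C x + c *\<^sub>C y"
    and scaleC_add_left: "(c + d) *\<^sub>C x = c *\<^sub>C x + d *\<^sub>C x"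
    and scaleC_scaleC: "c *\<^sub>C (d *\<^sub>C x) = (c * d) *\<^sub>C x"
    and scaleC_of_real: "complex_of_real r *\<^sub>C x = scaleR r x"
    and cinner_add_left: "cinner (x + y) z = cinner x z + cinner y z"
    and cinner_scaleC_left: "cinner (c *\<^sub>C x) y = c * cinner x y"
    and cinner_commute: "cinner y x = cnj (cinner x y)"
    and cinner_same: "cinner x x = complex_of_real ((norm x)\<^sup>2)"

lemma scaleC_one: "1 *\<^sub>C x = (x :: 'a::chilbert_space)"
  using scaleC_of_real[of 1 x] by simp

global_interpretation cvs: vector_space "scaleC :: complex \<Rightarrow> 'a \<Rightarrow> 'a::chilbert_space"
  by unfold_locales (simp_all add: scaleC_add_right scaleC_add_left scaleC_scaleC scaleC_one)

instantiation complex :: chilbert_space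
begin

definition "scaleC_complex (c::complex) (x::complex) = c * x"
definition "cinner_complex (x::complex) (y::complex) = x * cnj y"

instance
proof
  fix c d x y z :: complex and r :: real
  show "c *\<^sub>C (x + y) = c *\<^sub>C x + c *\<^sub>C y"
    unfolding scaleC_complex_def by (rule distrib_left)
  show "(c + d) *\<^sub>C x = c *\<^sub>C x + d *\<^sub>C x"
    unfolding scaleC_complex_def by (rule distrib_right)
  show "c *\<^sub>C (d *\<^sub>C x) = (c * d) *\<^sub>C x"
    unfolding scaleC_complex_def by (rule mult.assoc[symmetric])
  show "complex_of_real r *\<^sub>C x = scaleR r x"
    unfolding scaleC_complex_def by (rule scaleR_conv_of_real[symmetric])
  show "cinner (x + y) z = cinner x z + cinner y z"
    unfolding cinner_complex_def by (rule distrib_right)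
  show "cinner (c *\<^sub>C x) y = c * cinner x y"
    unfolding cinner_complex_def scaleC_complex_def by (rule mult.assoc)
  show "cinner y x = cnj (cinner x y)"
    unfolding cinner_complex_def by (simp add: mult.commute)
  show "cinner x x = complex_of_real ((norm x)\<^sup>2)"
    unfolding cinner_complex_def by (rule complex_norm_square[symmetric])
qed

end

definition bounded_selfadjoint :: "('a::chilbert_space \<Rightarrow> 'a) \<Rightarrow> bool" where
  "bounded_selfadjoint G \<longleftrightarrow>
     bounded_linear G \<and> (\<forall>c x. G (c *\<^sub>C x) = c *\<^sub>C G x) \<and>
     (\<forall>x y. cinner (G x) y = cinner x (G y))"

definition Ginner :: "('a::chilbert_space \<Rightarrow> 'a) \<Rightarrow> 'a \<Rightarrow> 'a \<Rightarrow> complex" where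
  "Ginner G x y = cinner (G x) y"

text \<open>An (unbounded) linear operator is given by its domain \<open>D\<close> and a function \<open>A\<close> of which only
  the values on \<open>D\<close> are relevant.\<close>

definition linear_operator :: "'a::chilbert_space set \<Rightarrow> ('a \<Rightarrow> 'a) \<Rightarrow> bool" where
  "linear_operator D A \<longleftrightarrow>
     cvs.subspace D \<and>
     (\<forall>x\<in>D. \<forall>y\<in>D. A (x + y) = A x + A y) \<and>
     (\<forall>c. \<forall>x\<in>D. A (c *\<^sub>C x) = c *\<^sub>C A x)"

definition closed_operator :: "'a::chilbert_space set \<Rightarrow> ('a \<Rightarrow> 'a) \<Rightarrow> bool" where
  "closed_operator D A \<longleftrightarrow> linear_operator D A \<and> closed {(x, A x) | x. x \<in> D}"

definition densely_defined :: "'a::chilbert_space set \<Rightarrow> bool" where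
  "densely_defined D \<longleftrightarrow> closure D = UNIV"

definition G_symmetric ::
  "('a::chilbert_space \<Rightarrow> 'a) \<Rightarrow> 'a set \<Rightarrow> ('a \<Rightarrow> 'a) \<Rightarrow> bool" where
  "G_symmetric G D A \<longleftrightarrow> (\<forall>x\<in>D. \<forall>y\<in>D. Ginner G (A x) y = Ginner G x (A y))"

definition resolvent :: "'a::chilbert_space set \<Rightarrow> ('a \<Rightarrow> 'a) \<Rightarrow> complex \<Rightarrow> 'a \<Rightarrow> 'a" where
  "resolvent D A l = inv_into D (\<lambda>x. A x - l *\<^sub>C x)"

definition resolvent_set :: "'a::chilbert_space set \<Rightarrow> ('a \<Rightarrow> 'a) \<Rightarrow> complex set" where
  "resolvent_set D A =
     {l. bij_betw (\<lambda>x. A x - l *\<^sub>C x) D UNIV \<and> bounded_linear (resolvent D A l)}"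

definition approx_eigenseq ::
  "'a::chilbert_space set \<Rightarrow> ('a \<Rightarrow> 'a) \<Rightarrow> complex \<Rightarrow> (nat \<Rightarrow> 'a) \<Rightarrow> bool" where
  "approx_eigenseq D A l x \<longleftrightarrow>
     (\<forall>n. x n \<in> D \<and> norm (x n) = 1) \<and> (\<lambda>n. A (x n) - l *\<^sub>C x n) \<longlonglongrightarrow> 0"

definition sigma_ap :: "'a::chilbert_space set \<Rightarrow> ('a \<Rightarrow> 'a) \<Rightarrow> complex set" where
  "sigma_ap D A = {l. \<exists>x. approx_eigenseq D A l x}"

text \<open>The quotient of the whole space by \<open>L\<close> is finite-dimensional, i.e. spanned by the classes of
  finitely many vectors.\<close>

definition finite_codim :: "'a::chilbert_space set \<Rightarrow> bool" where
  "finite_codim L \<longleftrightarrow> (\<exists>F. finite F \<and> (\<forall>x. \<exists>y\<in>L. \<exists>z\<in>cvs.span F. x = y + z))"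

text \<open>For selfadjoint \<open>G\<close> the values \<open>Ginner G x x\<close> are real, so taking the real part only changes
  the type. The limits inferior and superior are taken in the extended reals.\<close>

definition sigma_pi_plus ::
  "('a::chilbert_space \<Rightarrow> 'a) \<Rightarrow> 'a set \<Rightarrow> ('a \<Rightarrow> 'a) \<Rightarrow> complex set" where
  "sigma_pi_plus G D A = {l \<in> sigma_ap D A.
     \<exists>L. cvs.subspace L \<and> finite_codim L \<and>
       (\<forall>x. approx_eigenseq D A l x \<and> (\<forall>n. x n \<in> L) \<longrightarrow>
          liminf (\<lambda>n. ereal (Re (Ginner G (x n) (x n)))) > 0)}"

definition sigma_pi_minus ::
  "('a::chilbert_space \<Rightarrow> 'a) \<Rightarrow> 'a set \<Rightarrow> ('a \<Rightarrow> 'a) \<Rightarrow> complex set" where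
  "sigma_pi_minus G D A = {l \<in> sigma_ap D A.
     \<exists>L. cvs.subspace L \<and> finite_codim L \<and>
       (\<forall>x. approx_eigenseq D A l x \<and> (\<forall>n. x n \<in> L) \<longrightarrow>
          limsup (\<lambda>n. ereal (Re (Ginner G (x n) (x n)))) < 0)}"

end

theory Submission
  imports Defs
begin

text \<open>By compactness of \<open>[a,b]\<close> the estimate is local, and replacing \<open>G\<close> by \<open>- G\<close> reduces it to type
  \<open>\<pi>\<^sub>+\<close>. Near a point \<open>l0\<close> of the interval consider finite chains \<open>S\<close> of subspaces, built by adjoining
  \<open>v\<close> with \<open>(A - l0) v \<in> S\<close>, \<open>v\<close> being \<open>G\<close>-orthogonal to \<open>S\<close> and \<open>Ginner G v v \<le> 0\<close>. They are nonpositive and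
  consist of root vectors. Positivity on a subspace of finite codimension, together with the
  invertibility of \<open>A - l1\<close> for one non-real \<open>l1\<close> close to \<open>l0\<close>, excludes infinite chains. On the
  \<open>G\<close>-orthogonal companion of a maximal chain \<open>S\<close>, modulo \<open>S\<close>, the point \<open>l0\<close> is of positive type, and
  the identity \<open>Im [(A - l) u, u] = - Im l [u, u]\<close> gives a bound of order \<open>1 / \<bar>Im l\<bar>\<close>. Removing the vectors
  of the chain one at a time costs a factor \<open>1 / \<bar>Im l\<bar>\<^sup>2\<close> each.\<close>

section \<open>Complex Hilbert spaces and the indefinite form\<close>

text \<open>\<open>G\<close> may be singular, so a chain \<open>S\<close> can contain vectors that
  are \<open>G\<close>-orthogonal to all of \<open>S\<close>, and \<open>S\<close> together with its
  companion need not span the space: there is no projection along \<open>S\<close>. Hence estimates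
  are taken modulo \<open>S\<close>, with one free element of \<open>S\<close> in the residual and
  another in the vector itself. Since \<open>A\<close> is unbounded, vectors are written as
  \<open>R p\<close> with \<open>R\<close> the resolvent at \<open>l1\<close>; positivity then
  involves bounded operators only, passes to closures and survives weak limits. The positivity
  constants \<delta> and \<open>C\<close> depend on \<open>l0\<close> alone and are fixed before
  \<open>l1\<close>, so \<open>l1\<close> can be placed as close to \<open>l0\<close> as they
  require. The norm of \<open>R\<close> may be huge there, but in the argument against infinite
  chains it only multiplies errors that tend to 0. Vectors with nonpositive square are exactly what
  a failure of positivity leaves in the limit, which is why a maximal chain removes all failures at
  once. A chain built from \<open>k\<close> vectors yields the local exponent
  \<open>1 + 2 * k\<close>.\<close>

lemma cinner_add_right: "cinner x (y + z) = cinner x y + cinner x (z :: 'a::chilbert_space)"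
  by (metis cinner_add_left cinner_commute complex_cnj_add)

lemma cinner_scaleC_right: "cinner x (c *\<^sub>C y) = cnj c * cinner x (y :: 'a::chilbert_space)"
  by (metis cinner_commute cinner_scaleC_left complex_cnj_mult)

lemma norm_scaleC: "norm (c *\<^sub>C x) = cmod c * norm (x :: 'a::chilbert_space)"
proof -
  have "complex_of_real ((norm (c *\<^sub>C x))\<^sup>2) = (c * cnj c) * cinner x x"
    unfolding cinner_same[symmetric] by (simp add: cinner_scaleC_left cinner_scaleC_right)
  also have "\<dots> = complex_of_real ((cmod c * norm x)\<^sup>2)"
    by (simp only: complex_norm_square[symmetric] cinner_same power_mult_distrib of_real_mult)
  finally have "(norm (c *\<^sub>C x))\<^sup>2 = (cmod c * norm x)\<^sup>2"
    using of_real_eq_iff by blast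
  then show ?thesis by (rule power2_eq_imp_eq) auto
qed

lemma norm_add_square:
  "(norm (x + y :: 'a::chilbert_space))\<^sup>2 = (norm x)\<^sup>2 + 2 * Re (cinner x y) + (norm y)\<^sup>2"
proof -
  have "complex_of_real ((norm (x + y))\<^sup>2) = cinner x x + cinner x y + cnj (cinner x y) + cinner y y"
    unfolding cinner_same[symmetric]
    by (simp add: cinner_add_left cinner_add_right cinner_commute[of y x])
  then have "Re (complex_of_real ((norm (x + y))\<^sup>2)) = Re (cinner x x + cinner x y + cnj (cinner x y) + cinner y y)"
    by simp
  then show ?thesis by (simp add: cinner_same)
qed

lemma scaleC_minus_one: "(- 1) *\<^sub>C x = - (x :: 'a::chilbert_space)"
  using scaleC_of_real[of "-1" x] by simp

lemma cinner_minus_left: "cinner (- x) y = - cinner x (y :: 'a::chilbert_space)"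
  using cinner_scaleC_left[of "-1" x y] by (simp add: scaleC_minus_one)

lemma cinner_minus_right: "cinner x (- y) = - cinner x (y :: 'a::chilbert_space)"
  using cinner_scaleC_right[of x "-1" y] by (simp add: scaleC_minus_one)

lemma parallelogram:
  "(norm (x - y :: 'a::chilbert_space))\<^sup>2 = 2 * (norm x)\<^sup>2 + 2 * (norm y)\<^sup>2 - (norm (x + y))\<^sup>2"
  using norm_add_square[of x y] norm_add_square[of x "- y"] by (simp add: cinner_minus_right)

lemma cinner_Cauchy_Schwarz:
  "cmod (cinner x y) \<le> norm x * norm (y :: 'a::chilbert_space)"
proof (cases "x = 0 \<or> y = 0")
  case True
  then show ?thesis
    using cinner_scaleC_left[of 0 0 y] cinner_scaleC_right[of x 0 0] by auto
next
  case False
  define b where "b = (cmod (cinner x y))\<^sup>2"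
  define c where "c = - (cinner x y / complex_of_real ((norm y)\<^sup>2))"
  have ny: "(norm y)\<^sup>2 > 0" using False by simp
  have "cinner x (c *\<^sub>C y) = - complex_of_real (b / (norm y)\<^sup>2)"
    unfolding b_def c_def cinner_scaleC_right
    by (simp only: complex_cnj_minus complex_cnj_divide complex_cnj_complex_of_real of_real_divide
        complex_norm_square) (simp add: mult.commute)
  then have 1: "Re (cinner x (c *\<^sub>C y)) = - (b / (norm y)\<^sup>2)" by simp
  have 2: "(norm (c *\<^sub>C y))\<^sup>2 = b / (norm y)\<^sup>2"
    unfolding norm_scaleC c_def b_def using ny
    by (simp add: norm_divide power_mult_distrib power_divide field_simps power2_eq_square norm_mult)
  have "0 \<le> (norm x)\<^sup>2 - b / (norm y)\<^sup>2"
    using norm_add_square[of x "c *\<^sub>C y"] zero_le_power2[of "norm (x + c *\<^sub>C y)"] 1 2 by linarith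
  then have "b \<le> (norm x * norm y)\<^sup>2"
    using ny by (simp add: field_simps power_mult_distrib)
  then show ?thesis unfolding b_def by (rule power2_le_imp_le) simp
qed

lemma scaleR_scaleC: "r *\<^sub>R x = complex_of_real r *\<^sub>C (x :: 'a::chilbert_space)"
  by (simp add: scaleC_of_real)

lemma scaleC_scaleR_commute: "c *\<^sub>C (r *\<^sub>R x) = r *\<^sub>R (c *\<^sub>C (x :: 'a::chilbert_space))"
  by (simp add: scaleR_scaleC scaleC_scaleC mult.commute)

lemma bounded_bilinear_scaleC:
  "bounded_bilinear (scaleC :: complex \<Rightarrow> 'a \<Rightarrow> 'a::chilbert_space)"
proof
  show "(r *\<^sub>R c) *\<^sub>C x = r *\<^sub>R (c *\<^sub>C x)" for r c and x :: 'a
    by (simp add: scaleR_scaleC[of r "c *\<^sub>C x"] scaleC_scaleC scaleR_conv_of_real)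
  show "\<exists>K. \<forall>c (x::'a). norm (c *\<^sub>C x) \<le> norm c * norm x * K"
    by (rule exI[of _ 1]) (simp add: norm_scaleC)
qed (simp_all add: scaleC_add_right scaleC_add_left scaleC_scaleR_commute)

lemmas tendsto_scaleC = bounded_bilinear.tendsto[OF bounded_bilinear_scaleC]

lemma bounded_bilinear_Ginner:
  assumes "bounded_selfadjoint G"
  shows "bounded_bilinear (Ginner G)"
proof
  have G: "bounded_linear G" using assms by (simp add: bounded_selfadjoint_def)
  then obtain K where K: "\<And>x. norm (G x) \<le> norm x * K"
    using bounded_linear.bounded by blast
  show "Ginner G (x + y) z = Ginner G x z + Ginner G y z" for x y z
    using G by (simp add: Ginner_def linear_simps cinner_add_left)
  show "Ginner G x (y + z) = Ginner G x y + Ginner G x z" for x y z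
    by (simp add: Ginner_def cinner_add_right)
  show "Ginner G (r *\<^sub>R x) y = r *\<^sub>R Ginner G x y" for r x y
    using G by (simp add: Ginner_def linear_simps scaleR_scaleC[of r "G x"] cinner_scaleC_left
        scaleR_conv_of_real)
  show "Ginner G x (r *\<^sub>R y) = r *\<^sub>R Ginner G x y" for r x y
    by (simp add: Ginner_def scaleR_scaleC[of r y] cinner_scaleC_right scaleR_conv_of_real)
  show "\<exists>K. \<forall>x y. norm (Ginner G x y) \<le> norm x * norm y * K"
  proof (intro exI allI)
    fix x y
    have "norm (Ginner G x y) \<le> norm (G x) * norm y"
      unfolding Ginner_def by (rule cinner_Cauchy_Schwarz)
    also have "\<dots> \<le> (norm x * K) * norm y"
      by (rule mult_right_mono[OF K]) simp
    finally show "norm (Ginner G x y) \<le> norm x * norm y * K" by (simp add: mult_ac)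
  qed
qed

section \<open>Subspaces of finite codimension\<close>

definition extend :: "'a::chilbert_space \<Rightarrow> 'a set \<Rightarrow> 'a set" where
  "extend v S = {c *\<^sub>C v + s | c s. s \<in> S}"

lemma mem_extendI: "s \<in> S \<Longrightarrow> c *\<^sub>C v + s \<in> extend v S"
  unfolding extend_def by blast

lemma subset_extend: "S \<subseteq> extend v S"
proof
  fix x assume "x \<in> S"
  from mem_extendI[OF this, of 0 v] show "x \<in> extend v S" by simp
qed

lemma mem_extend_self: "cvs.subspace S \<Longrightarrow> v \<in> extend v S"
  using mem_extendI[OF cvs.subspace_0, of S 1 v] by (simp only: scaleC_one add_0_right)

lemma subspace_extend:
  assumes "cvs.subspace S"
  shows "cvs.subspace (extend v S)"
proof -
  have "0 \<in> extend v S" using subset_extend cvs.subspace_0[OF assms] by blast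
  moreover have "x + y \<in> extend v S" if "x \<in> extend v S" "y \<in> extend v S" for x y
  proof -
    from that obtain a s b t where "x = a *\<^sub>C v + s" "y = b *\<^sub>C v + t" "s \<in> S" "t \<in> S"
      unfolding extend_def by blast
    then have "x + y = (a + b) *\<^sub>C v + (s + t)" "s + t \<in> S"
      using cvs.subspace_add[OF assms] by (auto simp: scaleC_add_left)
    then show ?thesis using mem_extendI by metis
  qed
  moreover have "c *\<^sub>C x \<in> extend v S" if "x \<in> extend v S" for c x
  proof -
    from that obtain a s where "x = a *\<^sub>C v + s" "s \<in> S" unfolding extend_def by blast
    then have "c *\<^sub>C x = (c * a) *\<^sub>C v + c *\<^sub>C s" "c *\<^sub>C s \<in> S"
      using cvs.subspace_scale[OF assms] by (auto simp: scaleC_add_right scaleC_scaleC)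
    then show ?thesis using mem_extendI by metis
  qed
  ultimately show ?thesis unfolding cvs.subspace_def by blast
qed

text \<open>The distance from \<open>v\<close> to \<open>S\<close> is positive, and by homogeneity
  it serves as \<open>d\<close>: reading off the \<open>v\<close>-coefficient modulo
  \<open>S\<close> is a bounded functional.\<close>

lemma coefficient_bound:
  assumes "cvs.subspace S" "closed S" "v \<notin> S"
  obtains d where "d > 0" "\<And>c s. s \<in> S \<Longrightarrow> d * cmod c \<le> norm (c *\<^sub>C v + s)"
proof
  have ne: "S \<noteq> {}" using cvs.subspace_0[OF assms(1)] by auto
  show "infdist v S > 0" using infdist_pos_not_in_closed[OF assms(2) ne assms(3)] .
  fix c s assume s: "s \<in> S"
  show "infdist v S * cmod c \<le> norm (c *\<^sub>C v + s)"
  proof (cases "c = 0")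
    case False
    have "(- inverse c) *\<^sub>C s \<in> S" using s by (rule cvs.subspace_scale[OF assms(1)])
    then have "infdist v S \<le> dist v ((- inverse c) *\<^sub>C s)" by (rule infdist_le)
    then have "cmod c * infdist v S \<le> cmod c * norm (v - (- inverse c) *\<^sub>C s)"
      by (simp add: dist_norm mult_left_mono)
    also have "\<dots> = norm (c *\<^sub>C v + s)"
    proof -
      have "c *\<^sub>C (v - (- inverse c) *\<^sub>C s) = c *\<^sub>C v + s"
        unfolding cvs.scale_right_diff_distrib scaleC_scaleC using False by (simp add: scaleC_minus_one)
      then show ?thesis by (simp only: norm_scaleC[symmetric])
    qed
    finally show ?thesis by (simp add: mult.commute)
  qed simp
qed

text \<open>Bolzano-Weierstrass for the \<open>v\<close>-coefficients, which
  \<open>coefficient_bound\<close> keeps bounded. This replaces compactness in finite-dimensional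
  quotients.\<close>

lemma convergent_coefficients:
  fixes c :: "nat \<Rightarrow> complex"
  assumes S: "cvs.subspace S" "closed S" "v \<notin> S"
    and s: "\<And>n. s n \<in> S" and b: "\<And>n. norm (c n *\<^sub>C v + s n) \<le> B"
  obtains r a where "strict_mono r" "(c \<circ> r) \<longlonglongrightarrow> a"
proof -
  obtain d where d: "d > 0" "\<And>c s. s \<in> S \<Longrightarrow> d * cmod c \<le> norm (c *\<^sub>C v + s)"
    using coefficient_bound[OF S] by blast
  have "cmod (c n) \<le> B / d" for n
  proof -
    have "d * cmod (c n) \<le> B" using d(2)[OF s, of "c n" n] b[of n] by linarith
    then show ?thesis using d(1) by (simp add: field_simps)
  qed
  then have "bounded (range c)" by (auto simp: bounded_iff)
  from bounded_imp_convergent_subsequence[OF this]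
  obtain a r where "strict_mono r" "(c \<circ> r) \<longlonglongrightarrow> a" by blast
  then show ?thesis by (rule that)
qed

lemma closed_extend:
  assumes S: "cvs.subspace S" "closed S"
  shows "closed (extend v S)"
proof (cases "v \<in> S")
  case True
  have "extend v S \<subseteq> S"
    unfolding extend_def using cvs.subspace_add[OF S(1) cvs.subspace_scale[OF S(1) True]] by blast
  then have "extend v S = S" using subset_extend by blast
  then show ?thesis using S by simp
next
  case False
  show ?thesis
    unfolding closed_sequential_limits
  proof (intro allI impI, elim conjE)
    fix x l assume x: "\<forall>n. x n \<in> extend v S" and l: "x \<longlonglongrightarrow> l"
    from x have "\<forall>n. \<exists>c s. x n = c *\<^sub>C v + s \<and> s \<in> S" unfolding extend_def by blast
    then obtain c s where cs: "\<And>n. x n = c n *\<^sub>C v + s n" "\<And>n. s n \<in> S"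
      by metis
    from l have "bounded (range x)" by (rule convergent_imp_bounded)
    then obtain B where "\<And>n. norm (x n) \<le> B" by (auto simp: bounded_iff)
    then have "\<And>n. norm (c n *\<^sub>C v + s n) \<le> B" by (simp only: cs(1))
    then obtain r a where r: "strict_mono r" "(c \<circ> r) \<longlonglongrightarrow> a"
      by (rule convergent_coefficients[OF S False cs(2)])
    have "(\<lambda>n. (x \<circ> r) n - (c \<circ> r) n *\<^sub>C v) \<longlonglongrightarrow> l - a *\<^sub>C v"
      by (intro tendsto_diff tendsto_scaleC r tendsto_const LIMSEQ_subseq_LIMSEQ[OF l r(1)])
    then have "(\<lambda>n. s (r n)) \<longlonglongrightarrow> l - a *\<^sub>C v" by (simp add: cs(1))
    then have "l - a *\<^sub>C v \<in> S"
      by (rule closed_sequentially[OF S(2), rotated]) (rule cs(2))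
    then have "a *\<^sub>C v + (l - a *\<^sub>C v) \<in> extend v S" by (rule mem_extendI)
    then show "l \<in> extend v S" by simp
  qed
qed

lemma subspace_closure:
  assumes "cvs.subspace S"
  shows "cvs.subspace (closure S)"
  unfolding cvs.subspace_def
proof (intro conjI ballI allI)
  show "0 \<in> closure S" using cvs.subspace_0[OF assms] closure_subset by blast
next
  fix x y assume "x \<in> closure S" "y \<in> closure S"
  then obtain f g where "\<And>n. f n \<in> S" "f \<longlonglongrightarrow> x" "\<And>n. g n \<in> S" "g \<longlonglongrightarrow> y"
    unfolding closure_sequential by blast
  then show "x + y \<in> closure S"
    unfolding closure_sequential
    by (intro exI[of _ "\<lambda>n. f n + g n"]) (auto intro: tendsto_add cvs.subspace_add[OF assms])
next
  fix c x assume "x \<in> closure S"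
  then obtain f where "\<And>n. f n \<in> S" "f \<longlonglongrightarrow> x"
    unfolding closure_sequential by blast
  then show "c *\<^sub>C x \<in> closure S"
    unfolding closure_sequential
    by (intro exI[of _ "\<lambda>n. c *\<^sub>C f n"])
      (auto intro: tendsto_scaleC cvs.subspace_scale[OF assms])
qed

lemma finite_codim_mono: "finite_codim S \<Longrightarrow> S \<subseteq> T \<Longrightarrow> finite_codim T"
  unfolding finite_codim_def by (meson subsetD)

text \<open>The induction step for codimension: a spanning vector \<open>f\<close> moves from the
  finite complement into the subspace, so that no dimension has to be counted.\<close>

lemma span_insert_extend:
  assumes "y \<in> S" "z \<in> cvs.span (insert f F)"
  obtains y' z' where "y' \<in> extend f S" "z' \<in> cvs.span F" "y + z = y' + z'"
proof -
  obtain k where k: "z - k *\<^sub>C f \<in> cvs.span F"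
    using assms(2) unfolding cvs.span_breakdown_eq by blast
  have "k *\<^sub>C f + y \<in> extend f S" using assms(1) by (rule mem_extendI)
  then show ?thesis using k by (rule that) simp
qed

lemma finite_codim_vimage:
  fixes R :: "'a::chilbert_space \<Rightarrow> 'b::chilbert_space"
  assumes add: "\<And>x y. R (x + y) = R x + R y" and scale: "\<And>c x. R (c *\<^sub>C x) = c *\<^sub>C R x"
    and L: "cvs.subspace L" "finite_codim L"
  shows "finite_codim (R -` L)"
proof -
  obtain F where "finite F" and F: "\<forall>x. \<exists>y\<in>L. \<exists>z\<in>cvs.span F. x = y + z"
    using L(2) unfolding finite_codim_def by blast
  have "\<forall>x. \<exists>y\<in>L. \<exists>z\<in>cvs.span F. R x = y + z" using F by blast
  with \<open>finite F\<close> L(1) show ?thesis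
  proof (induction F arbitrary: L)
    case empty
    then have "R x \<in> L" for x by force
    then have "R -` L = UNIV" by auto
    then show ?case unfolding finite_codim_def
      by (intro exI[of _ "{}"]) auto
  next
    case (insert f F)
    have "\<forall>x. \<exists>y\<in>extend f L. \<exists>z\<in>cvs.span F. R x = y + z"
    proof
      fix x
      obtain y z where "y \<in> L" "z \<in> cvs.span (insert f F)" "R x = y + z"
        using insert.prems(2) by blast
      then show "\<exists>y\<in>extend f L. \<exists>z\<in>cvs.span F. R x = y + z"
        using span_insert_extend by metis
    qed
    from insert.IH[OF subspace_extend[OF insert.prems(1)] this]
    obtain F' where F': "finite F'" "\<forall>x. \<exists>y\<in>R -` extend f L. \<exists>z\<in>cvs.span F'. x = y + z"
      unfolding finite_codim_def by blast
    show ?case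
    proof (cases "\<exists>m c l. R m = c *\<^sub>C f + l \<and> c \<noteq> 0 \<and> l \<in> L")
      case True
      then obtain m c l where m: "R m = c *\<^sub>C f + l" "c \<noteq> 0" "l \<in> L" by blast
      have "\<exists>y\<in>R -` L. \<exists>z\<in>cvs.span (insert m F'). x = y + z" for x
      proof -
        obtain y z where yz: "R y \<in> extend f L" "z \<in> cvs.span F'" "x = y + z" using F' by blast
        then obtain k l' where k: "R y = k *\<^sub>C f + l'" "l' \<in> L" unfolding extend_def by blast
        have "R (y + (- (k / c)) *\<^sub>C m) = l' + (- (k / c)) *\<^sub>C l"
          using m(2) by (simp only: add scale k(1) m(1) scaleC_add_right scaleC_scaleC)
            (simp add: algebra_simps flip: scaleC_add_left)
        also have "\<dots> \<in> L" using cvs.subspace_add[OF insert.prems(1)] cvs.subspace_scale[OF insert.prems(1)]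
            k(2) m(3) by blast
        finally have 1: "y + (- (k / c)) *\<^sub>C m \<in> R -` L" by simp
        have "z + (k / c) *\<^sub>C m \<in> cvs.span (insert m F')"
          using yz(2) unfolding cvs.span_breakdown_eq by (intro exI[of _ "k / c"]) simp
        moreover have "x = (y + (- (k / c)) *\<^sub>C m) + (z + (k / c) *\<^sub>C m)"
          by (simp add: yz(3))
        ultimately show ?thesis using 1 by blast
      qed
      then show ?thesis unfolding finite_codim_def
        using F'(1) by (intro exI[of _ "insert m F'"] conjI) simp_all
    next
      case False
      have "R -` extend f L \<subseteq> R -` L"
      proof
        fix y assume "y \<in> R -` extend f L"
        then obtain c l where cl: "R y = c *\<^sub>C f + l" "l \<in> L" unfolding extend_def by blast
        then have "c = 0" using False by blast
        then show "y \<in> R -` L" using cl by simp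
      qed
      moreover have "finite_codim (R -` extend f L)"
        unfolding finite_codim_def using F' by (intro exI[of _ F'] conjI)
      ultimately show ?thesis by (rule finite_codim_mono[rotated])
    qed
  qed
qed

text \<open>Along a subsequence a bounded sequence lies in \<open>V\<close> up to a convergent
  correction, as if projected to a finite-dimensional complement. The induction enlarges
  \<open>V\<close> by one vector at a time; closedness keeps the coefficient of that vector bounded
  when it is new.\<close>

lemma finite_codim_subsequence:
  assumes V: "cvs.subspace V" "closed V" "finite_codim V" and b: "\<And>n. norm (y n) \<le> B"
  obtains r z l where "strict_mono (r :: nat \<Rightarrow> nat)" "z \<longlonglongrightarrow> l" "\<And>n. y (r n) - z n \<in> V"
proof -
  obtain F where "finite F" and F: "\<forall>x. \<exists>y\<in>V. \<exists>z\<in>cvs.span F. x = y + z"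
    using V(3) unfolding finite_codim_def by blast
  from \<open>finite F\<close> V(1,2) F have "\<exists>(r :: nat \<Rightarrow> nat) z l. strict_mono r \<and> z \<longlonglongrightarrow> l \<and> (\<forall>n. y (r n) - z n \<in> V)"
  proof (induction F arbitrary: V rule: finite_induct)
    case empty
    then have "x \<in> V" for x by force
    then show ?case
      by (intro exI[of _ id] exI[of _ "\<lambda>n. 0"] exI[of _ 0]) (auto simp: strict_mono_def)
  next
    case (insert f F)
    have "\<forall>x. \<exists>y\<in>extend f V. \<exists>z\<in>cvs.span F. x = y + z"
    proof
      fix x
      obtain y z where "y \<in> V" "z \<in> cvs.span (insert f F)" "x = y + z"
        using insert.prems(3) by blast
      then show "\<exists>y\<in>extend f V. \<exists>z\<in>cvs.span F. x = y + z"
        using span_insert_extend by metis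
    qed
    from insert.IH[OF subspace_extend[OF insert.prems(1)] closed_extend[OF insert.prems(1,2)] this]
    obtain r z l where r: "strict_mono (r :: nat \<Rightarrow> nat)" "z \<longlonglongrightarrow> l"
      and "\<forall>n. y (r n) - z n \<in> extend f V" by blast
    then have "\<forall>n. \<exists>c s. y (r n) - z n = c *\<^sub>C f + s \<and> s \<in> V" unfolding extend_def by blast
    then obtain c s where cs: "\<And>n. y (r n) - z n = c n *\<^sub>C f + s n" "\<And>n. s n \<in> V"
      by metis
    show ?case
    proof (cases "f \<in> V")
      case True
      then have "y (r n) - z n \<in> V" for n
        using cs[of n] cvs.subspace_add[OF insert.prems(1)] cvs.subspace_scale[OF insert.prems(1)] by simp
      then show ?thesis using r by blast
    next
      case False
      from r(2) have "bounded (range z)" by (rule convergent_imp_bounded)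
      then obtain B' where B': "\<And>n. norm (z n) \<le> B'" by (auto simp: bounded_iff)
      have "norm (c n *\<^sub>C f + s n) \<le> B + B'" for n
        unfolding cs(1)[symmetric] using norm_triangle_ineq4[of "y (r n)" "z n"] b[of "r n"] B'[of n]
        by linarith
      then obtain q a where q: "strict_mono q" "(c \<circ> q) \<longlonglongrightarrow> a"
        by (rule convergent_coefficients[OF insert.prems(1,2) False cs(2)])
      have "(\<lambda>n. (z \<circ> q) n + (c \<circ> q) n *\<^sub>C f) \<longlonglongrightarrow> l + a *\<^sub>C f"
        by (intro tendsto_add tendsto_scaleC q tendsto_const LIMSEQ_subseq_LIMSEQ[OF r(2) q(1)])
      moreover have "y ((r \<circ> q) n) - ((z \<circ> q) n + (c \<circ> q) n *\<^sub>C f) \<in> V" for n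
        using cs(1)[of "q n"] cs(2)[of "q n"] by (simp add: algebra_simps)
      moreover have "strict_mono (r \<circ> q)" using r(1) q(1) by (rule strict_mono_o)
      ultimately show ?thesis by blast
    qed
  qed
  then show ?thesis using that by blast
qed

text \<open>The infimum of the distances need not be attained; when it is positive, the factor 2
  leaves room to choose an actual element.\<close>

lemma exists_quasi_nearest:
  fixes S :: "'a::real_normed_vector set"
  assumes "closed S" "S \<noteq> {}"
  shows "\<exists>s\<in>S. \<forall>t\<in>S. norm (v - s) \<le> 2 * norm (v - t)"
proof (cases "v \<in> S")
  case True
  then show ?thesis by (intro bexI[of _ v]) auto
next
  case False
  have d: "infdist v S > 0" using infdist_pos_not_in_closed[OF assms False] .
  have "Inf {dist v a |a. a \<in> S} < 2 * infdist v S"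
    using d assms(2) by (simp add: infdist_def Setcompr_eq_image)
  then obtain s where s: "s \<in> S" "dist v s < 2 * infdist v S"
    using cInf_lessD[of "{dist v a |a. a \<in> S}"] assms(2) by blast
  have "norm (v - s) \<le> 2 * norm (v - t)" if "t \<in> S" for t
    using s(2) infdist_le[OF that, of v] by (simp add: dist_norm)
  then show ?thesis using s(1) by blast
qed

text \<open>Riesz's lemma with constant 1/2: subtract a quasi-nearest element of \<open>S\<close>
  from \<open>v\<close> and normalise.\<close>

lemma exists_far_unit_vector:
  assumes S: "cvs.subspace S" "closed S" "v \<notin> S"
  shows "\<exists>q\<in>extend v S. norm q = 1 \<and> (\<forall>s\<in>S. 1 / 2 \<le> norm (q - s))"
proof -
  obtain s where s: "s \<in> S" "\<forall>t\<in>S. norm (v - s) \<le> 2 * norm (v - t)"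
    using exists_quasi_nearest[OF S(2)] cvs.subspace_0[OF S(1)] by blast
  define N where "N = norm (v - s)"
  have N: "N > 0" using S(3) s(1) unfolding N_def by auto
  define q where "q = complex_of_real (1 / N) *\<^sub>C (v - s)"
  have q: "q = (1 / N) *\<^sub>R (v - s)" unfolding q_def by (rule scaleC_of_real)
  have "v - s \<in> extend v S"
    using cvs.subspace_diff[OF subspace_extend[OF S(1)] mem_extend_self[OF S(1)] subsetD[OF subset_extend s(1)]] .
  then have mem: "q \<in> extend v S"
    unfolding q_def using cvs.subspace_scale[OF subspace_extend[OF S(1)]] by blast
  have "norm q = 1" using N unfolding q N_def by simp
  moreover have "1 / 2 \<le> norm (q - t)" if t: "t \<in> S" for t
  proof -
    have "s + complex_of_real N *\<^sub>C t \<in> S"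
      by (rule cvs.subspace_add[OF S(1) s(1) cvs.subspace_scale[OF S(1) t]])
    then have "N \<le> 2 * norm (v - (s + N *\<^sub>R t))"
      using s(2) unfolding N_def scaleC_of_real by blast
    also have "v - (s + N *\<^sub>R t) = N *\<^sub>R (q - t)"
      using N unfolding q by (simp add: scaleR_diff_right)
    finally show ?thesis using N by simp
  qed
  ultimately show ?thesis using mem by blast
qed

section \<open>Convex cluster points\<close>

text \<open>A substitute for weak sequential compactness: near-minimal elements of the closed convex hulls
  of the tails form a Cauchy sequence by the parallelogram law.\<close>

lemma exists_convex_cluster_point:
  fixes y :: "nat \<Rightarrow> 'a::chilbert_space"
  assumes b: "\<And>n. norm (y n) \<le> B"
  obtains w where "\<And>C. closed C \<Longrightarrow> convex C \<Longrightarrow> eventually (\<lambda>n. y n \<in> C) sequentially \<Longrightarrow> w \<in> C"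
proof -
  define K where "K n = closure (convex hull (y ` {n..}))" for n
  define d where "d n = infdist 0 (K n)" for n
  have conv: "convex (K n)" for n unfolding K_def by (intro convex_closure convex_convex_hull)
  have yK: "y n \<in> K n" for n
    unfolding K_def using closure_subset hull_subset[of "y ` {n..}" convex] by fastforce
  have mono: "K n \<subseteq> K m" if "m \<le> n" for m n
    unfolding K_def using that by (intro closure_mono hull_mono) auto
  have dle: "d n \<le> norm x" if "x \<in> K n" for n x
    using infdist_le[OF that, of 0] by (simp add: d_def dist_norm)
  have d0: "0 \<le> d n" for n unfolding d_def by (rule infdist_nonneg)
  have "incseq d"
    unfolding d_def by (intro monoI infdist_mono mono) (use yK in auto)
  moreover have "d n \<le> B" for n using dle[OF yK[of n]] b[of n] by linarith
  ultimately obtain L where dL: "d \<longlonglongrightarrow> L"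
    using incseq_convergent by blast
  have "\<exists>x\<in>K n. norm x < d n + inverse (Suc n)" for n
  proof -
    have ne: "K n \<noteq> {}" using yK by blast
    have "Inf (dist 0 ` K n) < d n + inverse (Suc n)"
      using ne by (simp add: d_def infdist_def)
    then show ?thesis using cInf_lessD[of "dist 0 ` K n"] ne by (auto simp: dist_norm)
  qed
  then obtain w where w: "\<And>n. w n \<in> K n" "\<And>n. norm (w n) < d n + inverse (Suc n)" by metis
  have "(\<lambda>n. d n + inverse (Suc n)) \<longlonglongrightarrow> L + 0"
    by (intro tendsto_add dL LIMSEQ_inverse_real_of_nat)
  then have "(\<lambda>n. norm (w n)) \<longlonglongrightarrow> L"
    using tendsto_sandwich[OF _ _ dL, of "\<lambda>n. norm (w n)" "\<lambda>n. d n + inverse (Suc n)"]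
      dle[OF w(1)] less_imp_le[OF w(2)] by simp
  then have sq: "(\<lambda>n. (norm (w n))\<^sup>2) \<longlonglongrightarrow> L\<^sup>2" by (rule tendsto_power)
  have dsq: "(\<lambda>n. (d n)\<^sup>2) \<longlonglongrightarrow> L\<^sup>2" using dL by (rule tendsto_power)
  have "Cauchy w"
  proof (rule metric_CauchyI)
    fix e :: real assume "e > 0"
    then have e: "e\<^sup>2 / 8 > 0" by simp
    have "eventually (\<lambda>n. dist ((norm (w n))\<^sup>2) (L\<^sup>2) < e\<^sup>2 / 8 \<and> dist ((d n)\<^sup>2) (L\<^sup>2) < e\<^sup>2 / 8) sequentially"
      using tendstoD[OF sq e] tendstoD[OF dsq e] by eventually_elim simp
    then obtain n0 where n0: "\<And>n. n \<ge> n0 \<Longrightarrow> dist ((norm (w n))\<^sup>2) (L\<^sup>2) < e\<^sup>2 / 8"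
        "\<And>n. n \<ge> n0 \<Longrightarrow> dist ((d n)\<^sup>2) (L\<^sup>2) < e\<^sup>2 / 8"
      unfolding eventually_sequentially by blast
    have le: "dist (w m) (w n) < e" if "n0 \<le> m" "m \<le> n" for m n
    proof -
      \<comment> \<open>The midpoint stays in the convex set \<open>K m\<close>, so
        \<open>w m + w n\<close> has norm at least \<open>2 * d m\<close>. In the parallelogram law
        the tolerance enters eight times, whence the eighth of the square of
        \<open>e\<close>.\<close>
      have "(1 / 2) *\<^sub>R w m + (1 / 2) *\<^sub>R w n \<in> K m"
        using w(1)[of m] subsetD[OF mono[OF that(2)] w(1)] by (intro convexD[OF conv]) auto
      then have "d m \<le> norm ((1 / 2) *\<^sub>R (w m + w n))"
        using dle by (simp add: scaleR_add_right)
      then have "2 * d m \<le> norm (w m + w n)" by simp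
      then have "(2 * d m)\<^sup>2 \<le> (norm (w m + w n))\<^sup>2"
        using d0[of m] by (intro power_mono) auto
      then have "4 * (d m)\<^sup>2 \<le> (norm (w m + w n))\<^sup>2"
        by (simp add: power_mult_distrib)
      moreover have "(norm (w m))\<^sup>2 < L\<^sup>2 + e\<^sup>2 / 8" "(norm (w n))\<^sup>2 < L\<^sup>2 + e\<^sup>2 / 8"
        "(d m)\<^sup>2 > L\<^sup>2 - e\<^sup>2 / 8"
        using n0(1)[of m] n0(1)[of n] n0(2)[of m] that unfolding dist_real_def by linarith+
      ultimately have "(norm (w m - w n))\<^sup>2 < e\<^sup>2"
        using parallelogram[of "w m" "w n"] by linarith
      then show ?thesis using \<open>e > 0\<close> by (simp add: dist_norm power_less_imp_less_base)
    qed
    show "\<exists>n0. \<forall>m\<ge>n0. \<forall>n\<ge>n0. dist (w m) (w n) < e"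
      using le by (metis dist_commute nle_le)
  qed
  then obtain l where l: "w \<longlonglongrightarrow> l" using Cauchy_convergent convergent_def by blast
  have "l \<in> C" if C: "closed C" "convex C" "eventually (\<lambda>n. y n \<in> C) sequentially" for C
  proof -
    obtain N where N: "\<And>n. n \<ge> N \<Longrightarrow> y n \<in> C"
      using C(3) unfolding eventually_sequentially by blast
    have "K n \<subseteq> C" if "n \<ge> N" for n
      unfolding K_def using C N that by (intro closure_minimal hull_minimal) auto
    then have "eventually (\<lambda>n. w n \<in> C) sequentially"
      unfolding eventually_sequentially using w(1) by blast
    then show ?thesis using Lim_in_closed_set[OF C(1) _ _ l] by simp
  qed
  then show ?thesis by (rule that)
qed

text \<open>Preimages of closed balls under \<open>T\<close> are closed and convex, so a ball around
  \<open>l\<close> that contains the tail of \<open>T (y n)\<close> must contain \<open>T w\<close>;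
  half the distance from \<open>l\<close> to \<open>T w\<close> is a radius that forbids
  this.\<close>

lemma convex_cluster_point_tendsto:
  fixes T :: "'a::real_normed_vector \<Rightarrow> 'b::real_normed_vector"
  assumes w: "\<And>C. closed C \<Longrightarrow> convex C \<Longrightarrow> eventually (\<lambda>n. y n \<in> C) sequentially \<Longrightarrow> w \<in> C"
    and T: "bounded_linear T" and lim: "(\<lambda>n. T (y n)) \<longlonglongrightarrow> l"
  shows "T w = l"
proof (rule ccontr)
  assume ne: "T w \<noteq> l"
  define e where "e = dist l (T w) / 2"
  have e: "e > 0" using ne by (simp add: e_def)
  have "w \<in> T -` cball l e"
  proof (rule w)
    show "closed (T -` cball l e)"
      using linear_continuous_on[OF T] by (intro continuous_closed_vimage) (auto simp: continuous_on_eq_continuous_within)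
    show "convex (T -` cball l e)"
      by (intro convex_linear_vimage bounded_linear.linear[OF T] convex_cball)
    show "eventually (\<lambda>n. y n \<in> T -` cball l e) sequentially"
      using tendstoD[OF lim e] by eventually_elim (simp add: dist_commute less_imp_le)
  qed
  then show False using e by (simp add: e_def)
qed

section \<open>Algebra of the Hermitian form induced by \<open>G\<close>\<close>

lemma Ginner_scaleC_right: "Ginner G x (c *\<^sub>C y) = cnj c * Ginner G x y"
  by (simp add: Ginner_def cinner_scaleC_right)

lemma Ginner_scaleC_left:
  "bounded_selfadjoint G \<Longrightarrow> Ginner G (c *\<^sub>C x) y = c * Ginner G x y"
  by (simp add: Ginner_def bounded_selfadjoint_def cinner_scaleC_left)

lemma Ginner_commute: "bounded_selfadjoint G \<Longrightarrow> Ginner G y x = cnj (Ginner G x y)"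
  unfolding Ginner_def bounded_selfadjoint_def by (metis cinner_commute)

lemma Re_Ginner_add:
  assumes "bounded_selfadjoint G"
  shows "Re (Ginner G (x + y) (x + y)) = Re (Ginner G x x) + 2 * Re (Ginner G x y) + Re (Ginner G y y)"
  using Ginner_commute[OF assms, of y x]
  by (simp add: bounded_bilinear.add_left[OF bounded_bilinear_Ginner[OF assms]]
      bounded_bilinear.add_right[OF bounded_bilinear_Ginner[OF assms]])

lemma Re_Ginner_scaleC:
  assumes "bounded_selfadjoint G"
  shows "Re (Ginner G (c *\<^sub>C x) (c *\<^sub>C x)) = (cmod c)\<^sup>2 * Re (Ginner G x x)"
proof -
  have "Ginner G (c *\<^sub>C x) (c *\<^sub>C x) = (c * cnj c) * Ginner G x x"
    by (simp add: Ginner_scaleC_left[OF assms] Ginner_scaleC_right)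
  then show ?thesis unfolding complex_norm_square[symmetric] by simp
qed

section \<open>Chains of nonpositive root vectors\<close>

text \<open>The situation near a point \<open>l0\<close> of the interval: \<open>R\<close> is the resolvent at a nearby non-real
  point \<open>l1\<close>, and \<open>V_positive\<close> is the quantitative form of \<open>l0\<close> having type \<open>\<pi>\<^sub>+\<close>, with
  \<open>p + (l1 - l0) *\<^sub>C R p\<close> standing for \<open>(A - l0) R p\<close>.\<close>

locale positive_type_point =
  fixes G A R :: "'a::chilbert_space \<Rightarrow> 'a" and D V :: "'a set" and l0 l1 :: complex and \<delta> C :: real
  assumes G: "bounded_selfadjoint G"
    and A: "linear_operator D A"
    and G_symmetric: "G_symmetric G D A"
    and l0_real: "cnj l0 = l0"
    and R: "bounded_linear R"
    and R_scaleC: "\<And>c y. R (c *\<^sub>C y) = c *\<^sub>C R y"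
    and R_mem: "\<And>y. R y \<in> D"
    and R_right: "\<And>y. A (R y) = y + l1 *\<^sub>C R y"
    and R_left: "\<And>x. x \<in> D \<Longrightarrow> R (A x - l1 *\<^sub>C x) = x"
    and V: "cvs.subspace V" "closed V" "finite_codim V"
    and \<delta>: "\<delta> > 0" and C: "C > 0"
    and V_positive: "\<And>p. p \<in> V \<Longrightarrow> \<delta> * (norm (R p))\<^sup>2 \<le>
          Re (Ginner G (R p) (R p)) + C * (norm (p + (l1 - l0) *\<^sub>C R p))\<^sup>2"
    and l1_ne: "l1 \<noteq> l0"
    and l1_close: "1000 * C * (cmod (l1 - l0))\<^sup>2 < \<delta>"
begin

sublocale Gi: bounded_bilinear "Ginner G"
  by (rule bounded_bilinear_Ginner[OF G])

sublocale R: bounded_linear R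
  by (rule R)

lemma D_subspace: "cvs.subspace D"
  and A_add: "\<And>x y. x \<in> D \<Longrightarrow> y \<in> D \<Longrightarrow> A (x + y) = A x + A y"
  and A_scaleC: "\<And>c x. x \<in> D \<Longrightarrow> A (c *\<^sub>C x) = c *\<^sub>C A x"
  using A by (auto simp: linear_operator_def)

lemma A_diff: "x \<in> D \<Longrightarrow> y \<in> D \<Longrightarrow> A (x - y) = A x - A y"
  using A_add[of x "- y"] A_scaleC[of y "-1"] cvs.subspace_neg[OF D_subspace]
  by (simp add: scaleC_minus_one)

text \<open>Only the span is recorded, not the vectors. Orthogonality of each new \<open>v\<close>
  to its predecessors makes the form diagonal along the chain, so the sign passes to all of
  \<open>S\<close>; the condition on \<open>A v - l0 *\<^sub>C v\<close> makes \<open>A - l0\<close>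
  strictly triangular on it.\<close>

inductive root_chain :: "'a set \<Rightarrow> bool" where
  zero: "root_chain {0}"
| extend: "\<lbrakk>root_chain S; v \<in> D; v \<notin> S; \<And>s. s \<in> S \<Longrightarrow> Ginner G v s = 0; A v - l0 *\<^sub>C v \<in> S;
      Re (Ginner G v v) \<le> 0\<rbrakk> \<Longrightarrow> root_chain (extend v S)"

lemma root_chain_subspace: "root_chain S \<Longrightarrow> cvs.subspace S"
proof (induction rule: root_chain.induct)
  case zero
  show ?case by simp
next
  case (extend S v)
  then show ?case by (intro subspace_extend)
qed

lemma root_chain_closed: "root_chain S \<Longrightarrow> closed S"
proof (induction rule: root_chain.induct)
  case zero
  show ?case by simp
next
  case (extend S v)
  then show ?case by (intro closed_extend root_chain_subspace)
qed

lemma root_chain_domain: "root_chain S \<Longrightarrow> S \<subseteq> D"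
proof (induction rule: root_chain.induct)
  case zero
  show ?case using cvs.subspace_0[OF D_subspace] by simp
next
  case (extend S v)
  show ?case
  proof
    fix x assume "x \<in> extend v S"
    then obtain c s where "x = c *\<^sub>C v + s" "s \<in> S" unfolding extend_def by blast
    moreover have "s \<in> D" using extend.IH \<open>s \<in> S\<close> by blast
    ultimately show "x \<in> D"
      using cvs.subspace_add[OF D_subspace cvs.subspace_scale[OF D_subspace extend.hyps(2)]] by simp
  qed
qed

lemma root_chain_invariant: "root_chain S \<Longrightarrow> x \<in> S \<Longrightarrow> A x - l0 *\<^sub>C x \<in> S"
proof (induction arbitrary: x rule: root_chain.induct)
  case zero
  then show ?case using A_scaleC[OF cvs.subspace_0[OF D_subspace], of 0] by simp
next
  case (extend S v)
  then obtain c s where x: "x = c *\<^sub>C v + s" "s \<in> S" unfolding extend_def by blast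
  have "s \<in> D" using root_chain_domain[OF extend.hyps(1)] x(2) by blast
  then have "A x = c *\<^sub>C A v + A s"
    unfolding x(1) using extend.hyps(2) cvs.subspace_scale[OF D_subspace]
    by (simp add: A_add A_scaleC)
  then have "A x - l0 *\<^sub>C x = c *\<^sub>C (A v - l0 *\<^sub>C v) + (A s - l0 *\<^sub>C s)"
    unfolding x(1) by (simp add: algebra_simps scaleC_add_right cvs.scale_right_diff_distrib scaleC_scaleC)
  also have "\<dots> \<in> S"
    using root_chain_subspace[OF extend.hyps(1)] extend.hyps(5) extend.IH[OF x(2)]
    by (intro cvs.subspace_add cvs.subspace_scale)
  finally show ?case using subset_extend by blast
qed

lemma root_chain_invariant': "root_chain S \<Longrightarrow> x \<in> S \<Longrightarrow> A x - l *\<^sub>C x \<in> S"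
proof -
  assume S: "root_chain S" "x \<in> S"
  have "A x - l *\<^sub>C x = (A x - l0 *\<^sub>C x) + (l0 - l) *\<^sub>C x"
    by (simp add: cvs.scale_left_diff_distrib)
  then show "A x - l *\<^sub>C x \<in> S"
    using root_chain_invariant[OF S] cvs.subspace_add cvs.subspace_scale root_chain_subspace[OF S(1)] S(2)
    by metis
qed

text \<open>With \<open>t = (A - l0) v\<close> one has \<open>(A - l1) v = t + (l0 - l1) v\<close>.
  Applying \<open>R\<close> and solving for \<open>R v\<close> gives a multiple of \<open>v\<close>
  and a multiple of \<open>R t\<close>, and \<open>R t\<close> lies in \<open>S\<close>.\<close>

lemma root_chain_resolvent_mod:
  assumes R_S: "\<And>s. s \<in> S \<Longrightarrow> R s \<in> S" and S: "cvs.subspace S"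
    and v: "v \<in> D" "A v - l0 *\<^sub>C v \<in> S"
    and x: "x \<in> extend v S"
  shows "R x - inverse (l0 - l1) *\<^sub>C x \<in> S"
proof -
  define t where "t = A v - l0 *\<^sub>C v"
  define e where "e = inverse (l0 - l1)"
  have e: "e * (l0 - l1) = 1" using l1_ne by (simp add: e_def)
  have "A v - l1 *\<^sub>C v = t + (l0 - l1) *\<^sub>C v"
    unfolding t_def by (simp add: cvs.scale_left_diff_distrib)
  then have "R t + (l0 - l1) *\<^sub>C R v = v"
    using R_left[OF v(1)] by (simp add: R.add R_scaleC)
  then have "e *\<^sub>C (R t + (l0 - l1) *\<^sub>C R v) = e *\<^sub>C v" by simp
  then have "e *\<^sub>C R t + R v = e *\<^sub>C v"
    by (simp only: scaleC_add_right scaleC_scaleC e scaleC_one)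
  then have Rv: "R v - e *\<^sub>C v = - (e *\<^sub>C R t)"
    by (simp flip: \<open>e *\<^sub>C R t + R v = e *\<^sub>C v\<close>)
  obtain c s where x: "x = c *\<^sub>C v + s" "s \<in> S" using x unfolding extend_def by blast
  have "R x - e *\<^sub>C x = c *\<^sub>C (R v - e *\<^sub>C v) + (R s - e *\<^sub>C s)"
    unfolding x(1) by (simp add: R.add R_scaleC scaleC_add_right cvs.scale_right_diff_distrib scaleC_scaleC mult.commute)
  also have "\<dots> \<in> S"
    unfolding Rv using R_S x(2) v(2) S t_def
    by (intro cvs.subspace_add cvs.subspace_scale cvs.subspace_neg cvs.subspace_diff) auto
  finally show ?thesis unfolding e_def .
qed

lemma root_chain_resolvent: "root_chain S \<Longrightarrow> x \<in> S \<Longrightarrow> R x \<in> S"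
proof (induction arbitrary: x rule: root_chain.induct)
  case zero
  then show ?case by (simp add: R.zero)
next
  case (extend S v)
  have S: "cvs.subspace (extend v S)" using extend.hyps root_chain_subspace root_chain.extend by blast
  have "R x - inverse (l0 - l1) *\<^sub>C x \<in> extend v S"
    using root_chain_resolvent_mod[OF extend.IH root_chain_subspace[OF extend.hyps(1)] extend.hyps(2,5) extend.prems]
      subset_extend by blast
  then have "(R x - inverse (l0 - l1) *\<^sub>C x) + inverse (l0 - l1) *\<^sub>C x \<in> extend v S"
    by (intro cvs.subspace_add[OF S] cvs.subspace_scale[OF S] extend.prems)
  then show ?case by simp
qed

lemma root_chain_nonpositive: "root_chain S \<Longrightarrow> x \<in> S \<Longrightarrow> Re (Ginner G x x) \<le> 0"
proof (induction arbitrary: x rule: root_chain.induct)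
  case zero
  then show ?case by (simp add: Gi.zero_left)
next
  case (extend S v)
  then obtain c s where x: "x = c *\<^sub>C v + s" "s \<in> S" unfolding extend_def by blast
  have "Re (Ginner G x x) = (cmod c)\<^sup>2 * Re (Ginner G v v) + Re (Ginner G s s)"
    unfolding x(1) Re_Ginner_add[OF G] Re_Ginner_scaleC[OF G]
    by (simp add: Ginner_scaleC_left[OF G] extend.hyps(4)[OF x(2)])
  then show ?case using extend.IH[OF x(2)] extend.hyps(6)
    by (simp add: add_nonpos_nonpos mult_nonneg_nonpos)
qed

text \<open>A chain is finite-dimensional, so bounded sequences have limits in it and
  \<open>A\<close> is continuous on it. Both are obtained together, coordinate by coordinate,
  because \<open>A\<close> itself is not continuous on \<open>D\<close>.\<close>

lemma root_chain_compact:
  "root_chain S \<Longrightarrow> (\<And>n. x n \<in> S) \<Longrightarrow> (\<And>n. norm (x n) \<le> B) \<Longrightarrow>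
    \<exists>(r :: nat \<Rightarrow> nat) l. strict_mono r \<and> l \<in> S \<and> (\<lambda>n. x (r n)) \<longlonglongrightarrow> l \<and> (\<lambda>n. A (x (r n))) \<longlonglongrightarrow> A l"
proof (induction arbitrary: x B rule: root_chain.induct)
  case zero
  then show ?case by (intro exI[of _ id] exI[of _ 0]) (auto simp: strict_mono_def)
next
  case (extend S v)
  from extend.prems(1) have "\<forall>n. \<exists>c s. x n = c *\<^sub>C v + s \<and> s \<in> S" unfolding extend_def by blast
  then obtain c s where cs: "\<And>n. x n = c n *\<^sub>C v + s n" "\<And>n. s n \<in> S" by metis
  have S: "cvs.subspace S" "closed S"
    using root_chain_subspace root_chain_closed extend.hyps(1) by auto
  have "\<And>n. norm (c n *\<^sub>C v + s n) \<le> B" using extend.prems(2) by (simp only: cs(1))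
  then obtain r a where r: "strict_mono r" "(c \<circ> r) \<longlonglongrightarrow> a"
    by (rule convergent_coefficients[OF S extend.hyps(3) cs(2)])
  from r(2) have "bounded (range (c \<circ> r))" by (rule convergent_imp_bounded)
  then obtain B' where B': "\<And>n. norm (c (r n)) \<le> B'" by (auto simp: bounded_iff)
  have "norm (s (r n)) \<le> B + B' * norm v" for n
  proof -
    have "s (r n) = x (r n) - c (r n) *\<^sub>C v" by (simp add: cs(1))
    then have "norm (s (r n)) \<le> norm (x (r n)) + norm (c (r n) *\<^sub>C v)"
      by (simp only: norm_triangle_ineq4)
    also have "\<dots> \<le> B + B' * norm v"
      unfolding norm_scaleC by (intro add_mono mult_right_mono extend.prems B') simp
    finally show ?thesis .
  qed
  then have "\<exists>(q :: nat \<Rightarrow> nat) l. strict_mono q \<and> l \<in> S \<and> (\<lambda>n. s (r (q n))) \<longlonglongrightarrow> l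
      \<and> (\<lambda>n. A (s (r (q n)))) \<longlonglongrightarrow> A l"
    by (intro extend.IH[of "\<lambda>n. s (r n)"] cs(2))
  then obtain q l where q: "strict_mono (q :: nat \<Rightarrow> nat)" "l \<in> S" "(\<lambda>n. s (r (q n))) \<longlonglongrightarrow> l"
      "(\<lambda>n. A (s (r (q n)))) \<longlonglongrightarrow> A l" by blast
  have cq: "(\<lambda>n. c (r (q n))) \<longlonglongrightarrow> a" using LIMSEQ_subseq_LIMSEQ[OF r(2) q(1)] by (simp add: o_def)
  have Ax: "A (b *\<^sub>C v + t) = b *\<^sub>C A v + A t" if "t \<in> S" for b t
  proof -
    have "t \<in> D" using that root_chain_domain[OF extend.hyps(1)] by blast
    then show ?thesis using extend.hyps(2) cvs.subspace_scale[OF D_subspace] by (simp add: A_add A_scaleC)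
  qed
  have "(\<lambda>n. x (r (q n))) \<longlonglongrightarrow> a *\<^sub>C v + l"
    unfolding cs(1) by (intro tendsto_intros tendsto_scaleC cq q(3))
  moreover have "(\<lambda>n. A (x (r (q n)))) \<longlonglongrightarrow> A (a *\<^sub>C v + l)"
    unfolding cs(1) Ax[OF cs(2)] Ax[OF q(2)] by (intro tendsto_intros tendsto_scaleC cq q(4))
  moreover have "strict_mono (r \<circ> q)" using r(1) q(1) by (rule strict_mono_o)
  moreover have "a *\<^sub>C v + l \<in> extend v S" using q(2) by (rule mem_extendI)
  ultimately show ?case unfolding o_def by blast
qed

text \<open>On an infinite chain \<open>R\<close> acts as \<open>inverse (l0 - l1)\<close> modulo the preceding subspace, so the images
  of differences of unit vectors far from the preceding subspaces have norm at least
  \<open>1 / (2 * cmod (l1 - l0))\<close>; but those images are nonpositive and almost in \<open>R ` V\<close>, which bounds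
  their norm independently of \<open>l1\<close>.\<close>

lemma no_infinite_root_chain:
  assumes S: "\<And>n. root_chain (S n)" "\<And>n. S (Suc n) = extend (v n) (S n)"
    and v: "\<And>n. v n \<in> D" "\<And>n. v n \<notin> S n" "\<And>n. A (v n) - l0 *\<^sub>C v n \<in> S n"
  shows False
proof -
  define e where "e = inverse (l0 - l1)"
  define \<rho> where "\<rho> = cmod (l1 - l0)"
  have \<rho>: "\<rho> > 0" using l1_ne by (simp add: \<rho>_def)
  have e: "cmod e = 1 / \<rho>" "e \<noteq> 0" using l1_ne
    by (auto simp: e_def \<rho>_def norm_inverse norm_minus_commute divide_inverse)
  note sub = root_chain_subspace[OF S(1)]
  have S_mono: "S m \<subseteq> S n" if "m \<le> n" for m n
    using lift_Suc_mono_le[of S m n] subset_extend S(2) that by metis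
  have "\<exists>q\<in>S (Suc n). norm q = 1 \<and> (\<forall>s\<in>S n. 1 / 2 \<le> norm (q - s))" for n
    unfolding S(2) by (rule exists_far_unit_vector[OF sub root_chain_closed[OF S(1)] v(2)])
  then obtain q where q: "\<And>n. q n \<in> S (Suc n)" "\<And>n. norm (q n) = 1"
      "\<And>n s. s \<in> S n \<Longrightarrow> 1 / 2 \<le> norm (q n - s)" by metis
  obtain r z l where r: "strict_mono (r :: nat \<Rightarrow> nat)" and z: "z \<longlonglongrightarrow> l" and V_mem: "\<And>n. q (r n) - z n \<in> V"
    using finite_codim_subsequence[OF V, of q 1] q(2) by (metis order_refl)
  \<comment> \<open>Differences of consecutive terms turn the convergent correction \<open>z\<close>
    into one that tends to 0.\<close>
  define \<zeta> where "\<zeta> n = z (Suc n) - z n" for n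
  define a where "a n = R (q (r (Suc n)) - q (r n))" for n
  define p where "p n = q (r (Suc n)) - q (r n) - \<zeta> n" for n
  have \<zeta>: "\<zeta> \<longlonglongrightarrow> 0"
    using tendsto_diff[OF LIMSEQ_Suc[OF z] z] by (simp add: \<zeta>_def[abs_def])
  have p_V: "p n \<in> V" for n
  proof -
    have "p n = (q (r (Suc n)) - z (Suc n)) - (q (r n) - z n)" by (simp add: p_def \<zeta>_def)
    then show ?thesis using cvs.subspace_diff[OF V(1) V_mem V_mem] by metis
  qed
  \<comment> \<open>Since \<open>q (r n)\<close> lies in \<open>S (Suc (r n))\<close>, this shift
    puts it inside \<open>S (r (Suc n))\<close>, the space from which \<open>q (r (Suc n))\<close>
    stays away.\<close>
  have lt: "Suc (r n) \<le> r (Suc n)" for n using strict_monoD[OF r, of n "Suc n"] by simp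
  have a_low: "1 / (2 * \<rho>) \<le> norm (a n)" and a_nonpos: "Re (Ginner G (a n) (a n)) \<le> 0" for n
  proof -
    let ?i = "r (Suc n)"
    have mem: "q (r n) \<in> S ?i" using q(1) S_mono[OF lt] by blast
    define s where "s = (R (q ?i) - e *\<^sub>C q ?i) - R (q (r n))"
    have "R (q ?i) - e *\<^sub>C q ?i \<in> S ?i"
      unfolding e_def using q(1)[of ?i] unfolding S(2)
      by (intro root_chain_resolvent_mod[of "S ?i" "v ?i"] root_chain_resolvent[OF S(1)] sub v)
    then have s: "s \<in> S ?i"
      unfolding s_def using root_chain_resolvent[OF S(1) mem] by (rule cvs.subspace_diff[OF sub])
    have a_eq: "a n = e *\<^sub>C q ?i + s" unfolding a_def s_def by (simp add: R.diff)
    also have "\<dots> = e *\<^sub>C (q ?i - (- inverse e) *\<^sub>C s)"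
      unfolding cvs.scale_right_diff_distrib scaleC_scaleC using e(2) by (simp add: scaleC_minus_one)
    finally have "norm (a n) = (1 / \<rho>) * norm (q ?i - (- inverse e) *\<^sub>C s)"
      by (simp only: norm_scaleC e)
    moreover have "1 / 2 \<le> norm (q ?i - (- inverse e) *\<^sub>C s)"
      by (intro q(3) cvs.subspace_scale[OF sub] s)
    ultimately show "1 / (2 * \<rho>) \<le> norm (a n)" using \<rho> by (simp add: field_simps)
    have "a n \<in> S (Suc ?i)" unfolding a_eq
      using S_mono[of ?i "Suc ?i"] s
      by (intro cvs.subspace_add[OF sub] cvs.subspace_scale[OF sub] q(1)) auto
    then show "Re (Ginner G (a n) (a n)) \<le> 0" by (rule root_chain_nonpositive[OF S(1)])
  qed
  have R\<zeta>: "(\<lambda>n. R (\<zeta> n)) \<longlonglongrightarrow> 0" using R.tendsto[OF \<zeta>] by (simp add: R.zero)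
  obtain K where K: "K > 0" "\<And>x. norm (R x) \<le> norm x * K" using R.pos_bounded by blast
  obtain g where g: "g > 0" "\<And>x y. norm (Ginner G x y) \<le> norm x * norm y * g" using Gi.pos_bounded by blast
  have a_up: "norm (a n) \<le> 2 * K" for n
  proof -
    have "norm (q (r (Suc n)) - q (r n)) \<le> 2"
      using norm_triangle_ineq4[of "q (r (Suc n))" "q (r n)"] by (simp add: q(2))
    then show ?thesis unfolding a_def using K(2)[of "q (r (Suc n)) - q (r n)"]
      mult_right_mono[of _ 2 K] K(1) by (smt (verit))
  qed
  define \<epsilon> where "\<epsilon> n = 2 * (2 * K * norm (R (\<zeta> n)) * g) + norm (R (\<zeta> n)) * norm (R (\<zeta> n)) * g" for n
  have \<epsilon>: "\<epsilon> \<longlonglongrightarrow> 2 * (2 * K * 0 * g) + 0 * 0 * g"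
    unfolding \<epsilon>_def[abs_def] by (intro tendsto_intros tendsto_norm_zero R\<zeta>)
  \<comment> \<open>The value \<open>1 / (4 * \<rho>)\<close> is half of the lower bound for
    \<open>a n\<close>, so \<open>R (p n)\<close> keeps the other half. The bound \<epsilon> on the
    error in the form is compared with \<open>C\<close> so that \<open>C\<close> cancels at the
    end.\<close>
  have "eventually (\<lambda>n. \<epsilon> n < C \<and> norm (\<zeta> n) < 1 \<and> norm (R (\<zeta> n)) < 1 / (4 * \<rho>)) sequentially"
    using order_tendstoD(2)[OF \<epsilon>, of C] C order_tendstoD(2)[OF tendsto_norm_zero[OF \<zeta>], of 1]
      order_tendstoD(2)[OF tendsto_norm_zero[OF R\<zeta>], of "1 / (4 * \<rho>)"] \<rho>
    by (simp add: eventually_conj_iff)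
  then obtain n where n: "\<epsilon> n < C" "norm (\<zeta> n) < 1" "norm (R (\<zeta> n)) < 1 / (4 * \<rho>)"
    unfolding eventually_sequentially by blast
  define X where "X = norm (R (p n))"
  have Rp: "R (p n) = a n + - R (\<zeta> n)" by (simp add: p_def a_def R.diff)
  have "Re (Ginner G (R (p n)) (R (p n))) =
      Re (Ginner G (a n) (a n)) - 2 * Re (Ginner G (a n) (R (\<zeta> n))) + Re (Ginner G (R (\<zeta> n)) (R (\<zeta> n)))"
    unfolding Rp Re_Ginner_add[OF G] by (simp add: Gi.minus_left Gi.minus_right)
  also have "\<dots> \<le> \<epsilon> n"
  proof -
    have "norm (Ginner G (a n) (R (\<zeta> n))) \<le> 2 * K * norm (R (\<zeta> n)) * g"
      using g(2)[of "a n" "R (\<zeta> n)"] mult_right_mono[OF a_up[of n], of "norm (R (\<zeta> n)) * g"] g(1)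
      by (simp add: mult.assoc)
    then show ?thesis unfolding \<epsilon>_def
      using a_nonpos[of n] g(2)[of "R (\<zeta> n)" "R (\<zeta> n)"] abs_Re_le_cmod[of "Ginner G (a n) (R (\<zeta> n))"]
        abs_Re_le_cmod[of "Ginner G (R (\<zeta> n)) (R (\<zeta> n))"] by linarith
  qed
  finally have 1: "Re (Ginner G (R (p n)) (R (p n))) \<le> C" using n(1) by linarith
  have "norm (p n) \<le> 3"
    using norm_triangle_ineq4[of "q (r (Suc n)) - q (r n)" "\<zeta> n"] n(2)
      norm_triangle_ineq4[of "q (r (Suc n))" "q (r n)"] q(2) unfolding p_def by (smt (verit))
  then have "norm (p n + (l1 - l0) *\<^sub>C R (p n)) \<le> 3 + \<rho> * X"
    using norm_triangle_ineq[of "p n" "(l1 - l0) *\<^sub>C R (p n)"] unfolding norm_scaleC \<rho>_def X_def by linarith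
  then have "(norm (p n + (l1 - l0) *\<^sub>C R (p n)))\<^sup>2 \<le> (3 + \<rho> * X)\<^sup>2" by (intro power_mono) auto
  also have "\<dots> \<le> 18 + 2 * (\<rho> * X)\<^sup>2"
    using sum_squares_ge_zero[of "3 - \<rho> * X" 0] by (simp add: power2_eq_square algebra_simps)
  finally have "\<delta> * X\<^sup>2 \<le> C + C * (18 + 2 * (\<rho> * X)\<^sup>2)"
    using V_positive[OF p_V[of n]] 1 mult_left_mono[of _ _ C] C unfolding X_def[symmetric] by (smt (verit))
  \<comment> \<open>Closeness of \<open>l1\<close> absorbs the quadratic term:
    \<open>998 * (\<rho> * X)^2 \<le> 19\<close>, where \<open>19 = 1 + 18\<close> and 18 stems from
    \<open>(3 + a)^2 \<le> 18 + 2 * a^2\<close>. This contradicts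
    \<open>\<rho> * X \<ge> 1 / 4\<close>, as 998/16 exceeds 19; the constant 1000 is
    generous.\<close>
  moreover have "1000 * C * (\<rho> * X)\<^sup>2 \<le> \<delta> * X\<^sup>2"
    using mult_right_mono[OF less_imp_le[OF l1_close], of "X\<^sup>2"] unfolding \<rho>_def[symmetric]
    by (simp add: power_mult_distrib mult_ac)
  ultimately have "C * (998 * (\<rho> * X)\<^sup>2) \<le> C * 19" by (simp add: algebra_simps)
  then have "998 * (\<rho> * X)\<^sup>2 \<le> 19" using C by simp
  moreover have "1 / 4 \<le> \<rho> * X"
  proof -
    have "norm (a n) - norm (R (\<zeta> n)) \<le> X"
      unfolding X_def Rp using norm_triangle_ineq2[of "a n" "R (\<zeta> n)"] by simp
    then have "1 / (4 * \<rho>) \<le> X" using a_low[of n] n(3) by (simp add: field_simps)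
    then show ?thesis using \<rho> by (simp add: field_simps)
  qed
  then have "(1 / 4)\<^sup>2 \<le> (\<rho> * X)\<^sup>2" by (intro power_mono) auto
  ultimately show False by (simp add: power2_eq_square)
qed

definition maximal_root_chain :: "'a set \<Rightarrow> bool" where
  "maximal_root_chain S \<longleftrightarrow> root_chain S \<and>
     (\<forall>v\<in>D. (\<forall>s\<in>S. Ginner G v s = 0) \<longrightarrow> A v - l0 *\<^sub>C v \<in> S \<longrightarrow> Re (Ginner G v v) \<le> 0 \<longrightarrow> v \<in> S)"

text \<open>No bound on the length of chains is known in advance, hence dependent choice: if every
  chain could be extended, \<open>no_infinite_root_chain\<close> would be violated.\<close>

lemma exists_maximal_root_chain: "\<exists>S. maximal_root_chain S"
proof (rule ccontr)
  assume no: "\<nexists>S. maximal_root_chain S"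
  let ?P = "\<lambda>S T. \<exists>v. T = extend v S \<and> v \<in> D \<and> v \<notin> S \<and> A v - l0 *\<^sub>C v \<in> S"
  have step: "\<exists>T. root_chain T \<and> ?P S T" if S: "root_chain S" for S
  proof -
    obtain v where v: "v \<in> D" "\<And>s. s \<in> S \<Longrightarrow> Ginner G v s = 0" "A v - l0 *\<^sub>C v \<in> S"
        "Re (Ginner G v v) \<le> 0" "v \<notin> S"
      using no S unfolding maximal_root_chain_def by blast
    then have "root_chain (extend v S)" by (intro root_chain.extend S)
    then show ?thesis using v by blast
  qed
  have "\<exists>S. \<forall>n. root_chain (S n) \<and> ?P (S n) (S (Suc n))"
    using step root_chain.zero by (intro dependent_nat_choice) blast+
  then obtain S where S: "\<And>n. root_chain (S n)" "\<And>n. ?P (S n) (S (Suc n))" by blast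
  then have "\<forall>n. ?P (S n) (S (Suc n))" by blast
  then obtain v where "\<And>n. S (Suc n) = extend (v n) (S n)" "\<And>n. v n \<in> D" "\<And>n. v n \<notin> S n"
      "\<And>n. A (v n) - l0 *\<^sub>C v n \<in> S n" by metis
  then show False using no_infinite_root_chain[of S v] S(1) by blast
qed

section \<open>Positivity relative to a maximal chain\<close>

text \<open>A sequence of counterexamples has a convex cluster point \<open>v\<close>. Positivity on \<open>V\<close> forces
  \<open>Ginner G v v \<le> 0\<close>, hence \<open>v \<in> S\<close> by maximality, and then it forces norm convergence to \<open>v\<close>, against
  quasi-minimality.\<close>

lemma maximal_root_chain_positive_unit:
  assumes S: "maximal_root_chain S"
  shows "\<exists>\<epsilon>>0. \<forall>u\<in>D. \<forall>s\<in>S. norm u = 1 \<longrightarrow> (\<forall>t\<in>S. Ginner G u t = 0) \<longrightarrow>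
      (\<forall>t\<in>S. (\<forall>t'\<in>S. Ginner G t t' = 0) \<longrightarrow> 1 \<le> 2 * norm (u - t)) \<longrightarrow>
      norm (A u - l0 *\<^sub>C u - s) \<le> \<epsilon> \<longrightarrow> \<epsilon> \<le> Re (Ginner G u u)"
proof (rule ccontr)
  assume no: "\<not> ?thesis"
  have chain: "root_chain S" using S by (simp add: maximal_root_chain_def)
  have "\<exists>u s. u \<in> D \<and> s \<in> S \<and> norm u = 1 \<and> (\<forall>t\<in>S. Ginner G u t = 0) \<and>
      (\<forall>t\<in>S. (\<forall>t'\<in>S. Ginner G t t' = 0) \<longrightarrow> 1 \<le> 2 * norm (u - t)) \<and>
      norm (A u - l0 *\<^sub>C u - s) \<le> inverse (Suc n) \<and> Re (Ginner G u u) < inverse (Suc n)" for n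
  proof -
    have "inverse (real (Suc n)) > 0" by simp
    then show ?thesis using no not_le by metis
  qed
  then obtain u s where u: "\<And>n. u n \<in> D" "\<And>n. s n \<in> S" "\<And>n. norm (u n) = 1"
      "\<And>n t. t \<in> S \<Longrightarrow> Ginner G (u n) t = 0"
      "\<And>n t. t \<in> S \<Longrightarrow> (\<forall>t'\<in>S. Ginner G t t' = 0) \<Longrightarrow> 1 \<le> 2 * norm (u n - t)"
      "\<And>n. norm (A (u n) - l0 *\<^sub>C u n - s n) \<le> inverse (Suc n)"
      "\<And>n. Re (Ginner G (u n) (u n)) < inverse (Suc n)"
    by metis
  obtain K where K: "K > 0" "\<And>x. norm (R x) \<le> norm x * K" using R.pos_bounded by blast
  obtain g where g: "g > 0" "\<And>x y. norm (Ginner G x y) \<le> norm x * norm y * g" using Gi.pos_bounded by blast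
  define f where "f n = A (u n) - l0 *\<^sub>C u n - s n" for n
  have f: "f \<longlonglongrightarrow> 0"
    using u(6) by (intro Lim_null_comparison[OF _ LIMSEQ_inverse_real_of_nat] always_eventually)
      (simp add: f_def)
  have f_le: "norm (f n) \<le> 1" for n
    using u(6)[of n] inverse_le_1_iff[of "real (Suc n)"] unfolding f_def by linarith
  \<comment> \<open>The vectors \<open>s n\<close> are not bounded a priori, because
    \<open>A (u n)\<close> is not. Their images under \<open>R\<close> are, since \<open>R\<close>
    undoes \<open>A - l1\<close>; compactness of the chain, including continuity of \<open>A\<close>
    there, then makes \<open>s n\<close> itself converge along a subsequence.\<close>
  have "norm (R (s n)) \<le> 1 + cmod (l1 - l0) * K + K" for n
  proof -
    have "s n = (A (u n) - l1 *\<^sub>C u n) + (l1 - l0) *\<^sub>C u n - f n"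
      by (simp add: f_def cvs.scale_left_diff_distrib)
    then have "R (s n) = R ((A (u n) - l1 *\<^sub>C u n) + (l1 - l0) *\<^sub>C u n - f n)" by (rule arg_cong)
    also have "\<dots> = u n + (l1 - l0) *\<^sub>C R (u n) - R (f n)"
      by (simp only: R.diff[of _ "f n"] R.add R_scaleC R_left[OF u(1)])
    finally have "R (s n) = u n + (l1 - l0) *\<^sub>C R (u n) - R (f n)" .
    then have "norm (R (s n)) \<le> norm (u n) + norm ((l1 - l0) *\<^sub>C R (u n)) + norm (R (f n))"
      by (simp only:) (use norm_triangle_ineq4[of "u n + (l1 - l0) *\<^sub>C R (u n)" "R (f n)"]
        norm_triangle_ineq[of "u n" "(l1 - l0) *\<^sub>C R (u n)"] in linarith)
    moreover have "norm ((l1 - l0) *\<^sub>C R (u n)) \<le> cmod (l1 - l0) * K"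
      unfolding norm_scaleC using K(2)[of "u n"] u(3) by (intro mult_left_mono) auto
    moreover have "norm (R (f n)) \<le> K"
      using K(2)[of "f n"] mult_right_mono[OF f_le[of n], of K] K(1) by linarith
    ultimately show ?thesis using u(3)[of n] by linarith
  qed
  from root_chain_compact[OF chain, of "\<lambda>n. R (s n)", OF root_chain_resolvent[OF chain u(2)] this]
  obtain r1 t where r1: "strict_mono (r1 :: nat \<Rightarrow> nat)" and t: "t \<in> S"
    "(\<lambda>n. R (s (r1 n))) \<longlonglongrightarrow> t" "(\<lambda>n. A (R (s (r1 n)))) \<longlonglongrightarrow> A t"
    by blast
  define s0 where "s0 = A t - l1 *\<^sub>C t"
  have s0: "s0 \<in> S" unfolding s0_def by (rule root_chain_invariant'[OF chain t(1)])
  have "(\<lambda>n. A (R (s (r1 n))) - l1 *\<^sub>C R (s (r1 n))) \<longlonglongrightarrow> s0"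
    unfolding s0_def by (intro tendsto_intros tendsto_scaleC t)
  then have s_lim: "(\<lambda>n. s (r1 n)) \<longlonglongrightarrow> s0" unfolding R_right by simp
  have "bounded (range (\<lambda>n. s (r1 n)))" using s_lim by (rule convergent_imp_bounded)
  then obtain B where B: "\<And>n. norm (s (r1 n)) \<le> B" by (auto simp: bounded_iff)
  \<comment> \<open>The weak limit is taken of \<open>y n\<close> and carried back by
    \<open>R\<close>; this puts the limit vector into \<open>D\<close> and makes \<open>A\<close>
    accessible on it.\<close>
  define y where "y n = A (u n) - l1 *\<^sub>C u n" for n
  have y_eq: "y n = f n + s n + (l0 - l1) *\<^sub>C u n" for n
    by (simp add: y_def f_def cvs.scale_left_diff_distrib)
  have Ry: "R (y n) = u n" for n unfolding y_def by (rule R_left[OF u(1)])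
  have "norm (y (r1 n)) \<le> 1 + B + cmod (l0 - l1)" for n
    unfolding y_eq using norm_triangle_ineq[of "f (r1 n) + s (r1 n)" "(l0 - l1) *\<^sub>C u (r1 n)"]
      norm_triangle_ineq[of "f (r1 n)" "s (r1 n)"] f_le[of "r1 n"] B[of n] u(3)
    unfolding norm_scaleC by simp
  from finite_codim_subsequence[OF V, of "\<lambda>n. y (r1 n)", OF this]
  obtain r2 z l where r2: "strict_mono (r2 :: nat \<Rightarrow> nat)" and z: "z \<longlonglongrightarrow> l"
    and zV: "\<And>n. y (r1 (r2 n)) - z n \<in> V" by blast
  define k where "k n = r1 (r2 n)" for n
  have k: "strict_mono k" using strict_mono_o[OF r1 r2] by (simp add: k_def[abs_def] o_def)
  have fk: "(\<lambda>n. f (k n)) \<longlonglongrightarrow> 0" using LIMSEQ_subseq_LIMSEQ[OF f k] by (simp add: o_def)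
  have sk: "(\<lambda>n. s (k n)) \<longlonglongrightarrow> s0"
    using LIMSEQ_subseq_LIMSEQ[OF s_lim r2] by (simp add: o_def k_def)
  \<comment> \<open>Replacing the varying correction \<open>z n\<close> by its limit keeps
    \<open>x n\<close> in the fixed closed convex set \<open>l + V\<close>. A cluster point
    \<open>w\<close> lies there too, so \<open>x n - w\<close> is in \<open>V\<close> and positivity
    applies to it.\<close>
  define x where "x n = y (k n) + (l - z n)" for n
  have lz: "(\<lambda>n. l - z n) \<longlonglongrightarrow> 0" using tendsto_diff[OF tendsto_const z, of l] by simp
  have Rlz: "(\<lambda>n. R (l - z n)) \<longlonglongrightarrow> 0" using R.tendsto[OF lz] by (simp add: R.zero)
  have Rx: "R (x n) = u (k n) + R (l - z n)" for n by (simp add: x_def R.add Ry)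
  have xV: "x n - l \<in> V" for n using zV[of n] by (simp add: x_def k_def)
  have "bounded (range (\<lambda>n. l - z n))" using lz by (rule convergent_imp_bounded)
  then obtain B' where B': "\<And>n. norm (l - z n) \<le> B'" by (auto simp: bounded_iff)
  have x_le: "norm (x n) \<le> 1 + B + cmod (l0 - l1) + B'" for n
    using norm_triangle_ineq[of "y (k n)" "l - z n"] B'[of n]
      \<open>\<And>n. norm (y (r1 n)) \<le> 1 + B + cmod (l0 - l1)\<close>[of "r2 n"]
    unfolding x_def k_def by linarith
  obtain w where w: "\<And>C. closed C \<Longrightarrow> convex C \<Longrightarrow> eventually (\<lambda>n. x n \<in> C) sequentially \<Longrightarrow> w \<in> C"
    using exists_convex_cluster_point[of x, OF x_le] by metis
  define v where "v = R w"
  have vD: "v \<in> D" unfolding v_def by (rule R_mem)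
  have wV: "w - l \<in> V"
  proof -
    have "w \<in> (+) l ` V"
    proof (rule w)
      show "closed ((+) l ` V)" using V(2) by (rule closed_translation)
      have "convex V"
        unfolding convex_def
        using cvs.subspace_add[OF V(1) cvs.subspace_scale[OF V(1)] cvs.subspace_scale[OF V(1)]]
        by (metis scaleC_of_real)
      then show "convex ((+) l ` V)" by (rule convex_translation)
      have "x n \<in> (+) l ` V" for n using xV[of n] by (intro image_eqI[of _ _ "x n - l"]) auto
      then show "\<forall>\<^sub>F n in sequentially. x n \<in> (+) l ` V" by simp
    qed
    then show ?thesis by auto
  qed
  have xwV: "x n - w \<in> V" for n
    using cvs.subspace_diff[OF V(1) xV[of n] wV] by simp
  \<comment> \<open>\<open>T\<close> is \<open>(A - l0) R\<close> written as a bounded operator.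
    Along \<open>x n\<close> it converges in norm to \<open>s0\<close>, which fixes its value at
    \<open>w\<close>.\<close>
  define T where "T p = p + (l1 - l0) *\<^sub>C R p" for p
  have T: "bounded_linear T"
    unfolding T_def[abs_def]
    by (intro bounded_linear_add bounded_linear_ident
        bounded_linear_compose[OF bounded_bilinear.bounded_linear_right[OF bounded_bilinear_scaleC] R])
  have "T (x n) = f (k n) + s (k n) + T (l - z n)" for n
    unfolding T_def Rx unfolding x_def y_eq
    by (simp add: scaleC_add_right cvs.scale_left_diff_distrib)
  moreover have "(\<lambda>n. f (k n) + s (k n) + T (l - z n)) \<longlonglongrightarrow> 0 + s0 + T 0"
    by (intro tendsto_intros fk sk bounded_linear.tendsto[OF T] lz)
  ultimately have Tx: "(\<lambda>n. T (x n)) \<longlonglongrightarrow> s0"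
    by (simp add: linear_simps(3)[OF T])
  have Tw: "T w = s0" by (rule convex_cluster_point_tendsto[OF w T Tx])
  have Av: "A v - l0 *\<^sub>C v \<in> S"
    using s0 unfolding Tw[symmetric] v_def T_def R_right by (simp add: cvs.scale_left_diff_distrib add_diff_eq)
  have v_orth: "Ginner G v t' = 0" if t': "t' \<in> S" for t'
    unfolding v_def
  proof (rule convex_cluster_point_tendsto[OF w])
    show "bounded_linear (\<lambda>p. Ginner G (R p) t')"
      by (rule bounded_linear_compose[OF Gi.bounded_linear_left R])
    have "(\<lambda>n. Ginner G (R (l - z n)) t') \<longlonglongrightarrow> Ginner G 0 t'"
      by (intro Gi.tendsto Rlz tendsto_const)
    then show "(\<lambda>n. Ginner G (R (x n)) t') \<longlonglongrightarrow> 0"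
      by (simp add: Rx Gi.add_left u(4)[OF t'] Gi.zero_left)
  qed
  define h where "h n = R (l - z n)" for n
  have h: "h \<longlonglongrightarrow> 0" unfolding h_def[abs_def] by (rule Rlz)
  define \<omega> where "\<omega> n = (2 * ((1 + norm v) * norm (h n) * g) + norm (h n) * norm (h n) * g) +
      C * (norm (T (x n) - s0))\<^sup>2 + inverse (Suc (k n))" for n
  have \<omega>: "\<omega> \<longlonglongrightarrow> 0"
  proof -
    have "(\<lambda>n. inverse (real (Suc (k n)))) \<longlonglongrightarrow> 0"
      using LIMSEQ_subseq_LIMSEQ[OF LIMSEQ_inverse_real_of_nat k] by (simp add: o_def)
    then have "\<omega> \<longlonglongrightarrow> (2 * ((1 + norm v) * 0 * g) + 0 * 0 * g) + C * (norm (s0 - s0))\<^sup>2 + 0"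
      unfolding \<omega>_def[abs_def] by (intro tendsto_intros tendsto_norm_zero h Tx)
    then show ?thesis by simp
  qed
  \<comment> \<open>Positivity for \<open>x n - w\<close>, with the form expanded around
    \<open>u (k n) - v\<close>. The square of \<open>u (k n)\<close> is at most
    \<open>inverse (Suc (k n))\<close> by the choice of the counterexamples, so \<omega> collects
    only vanishing terms.\<close>
  have main: "\<delta> * (norm (R (x n) - v))\<^sup>2 \<le> \<omega> n - 2 * Re (Ginner G (u (k n)) v) + Re (Ginner G v v)" for n
  proof -
    let ?U = "u (k n)"
    have eq: "R (x n - w) = (?U - v) + h n" by (simp add: R.diff Rx v_def h_def)
    have 1: "norm (Ginner G (?U - v) (h n)) \<le> (1 + norm v) * norm (h n) * g"
    proof -
      have "norm (?U - v) \<le> 1 + norm v" using norm_triangle_ineq4[of ?U v] u(3) by simp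
      then have "norm (?U - v) * (norm (h n) * g) \<le> (1 + norm v) * (norm (h n) * g)"
        using g(1) by (intro mult_right_mono) auto
      then show ?thesis using g(2)[of "?U - v" "h n"] by (simp add: mult.assoc)
    qed
    have "Re (Ginner G (?U - v) (?U - v)) =
        Re (Ginner G ?U ?U) - 2 * Re (Ginner G ?U v) + Re (Ginner G v v)"
      using Re_Ginner_add[OF G, of ?U "- v"] by (simp add: Gi.minus_left Gi.minus_right)
    then have 2: "Re (Ginner G (?U - v) (?U - v)) \<le>
        inverse (Suc (k n)) - 2 * Re (Ginner G ?U v) + Re (Ginner G v v)"
      using u(7)[of "k n"] by linarith
    have 3: "Re (Ginner G (R (x n - w)) (R (x n - w))) \<le> Re (Ginner G (?U - v) (?U - v)) +
        (2 * ((1 + norm v) * norm (h n) * g) + norm (h n) * norm (h n) * g)"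
      unfolding eq Re_Ginner_add[OF G]
      using 1 g(2)[of "h n" "h n"] complex_Re_le_cmod[of "Ginner G (?U - v) (h n)"]
        complex_Re_le_cmod[of "Ginner G (h n) (h n)"] by linarith
    have "(x n - w) + (l1 - l0) *\<^sub>C R (x n - w) = T (x n) - s0"
      using linear_simps(2)[OF T, of "x n" w] unfolding Tw unfolding T_def .
    then have "\<delta> * (norm (R (x n - w)))\<^sup>2 \<le>
        Re (Ginner G (R (x n - w)) (R (x n - w))) + C * (norm (T (x n) - s0))\<^sup>2"
      using V_positive[OF xwV[of n]] by simp
    then show ?thesis using 2 3 unfolding \<omega>_def by (simp add: R.diff v_def)
  qed
  have "Re (Ginner G v v) \<le> 0"
  proof (rule ccontr)
    assume "\<not> ?thesis"
    then have pos: "Re (Ginner G v v) / 8 > 0" by simp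
    let ?c = "Re (Ginner G v v)"
    let ?\<phi> = "\<lambda>p. Re (Ginner G (R p) v)"
    have \<phi>: "bounded_linear ?\<phi>"
      by (intro bounded_linear_compose[OF bounded_linear_Re] bounded_linear_compose[OF Gi.bounded_linear_left R])
    \<comment> \<open>By \<open>main\<close>, \<open>2 * Re (Ginner G (u (k n)) v)\<close> is at
      most \<open>?c\<close> plus an error below \<open>?c / 8\<close>. With the further error below
      \<open>?c / 8\<close> this gives \<open>11/16 * ?c\<close>, hence membership in this
      half-space. The cluster point has value \<open>?c\<close> there, which is impossible for
      positive \<open>?c\<close>.\<close>
    have "w \<in> ?\<phi> -` {..3 / 4 * ?c}"
    proof (rule w)
      show "closed (?\<phi> -` {..3 / 4 * ?c})"
        using linear_continuous_on[OF \<phi>] by (intro continuous_closed_vimage) (auto simp: continuous_on_eq_continuous_within)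
      show "convex (?\<phi> -` {..3 / 4 * ?c})"
        by (intro convex_linear_vimage bounded_linear.linear[OF \<phi>] convex_real_interval)
      have "(\<lambda>n. Re (Ginner G (h n) v)) \<longlonglongrightarrow> Re (Ginner G 0 v)"
        by (intro tendsto_intros Gi.tendsto h)
      then have "(\<lambda>n. Re (Ginner G (h n) v)) \<longlonglongrightarrow> 0" by (simp add: Gi.zero_left)
      from order_tendstoD(2)[OF this pos] order_tendstoD(2)[OF \<omega> pos]
      show "\<forall>\<^sub>F n in sequentially. x n \<in> ?\<phi> -` {..3 / 4 * ?c}"
      proof eventually_elim
        case (elim n)
        have "0 \<le> \<delta> * (norm (R (x n) - v))\<^sup>2" using \<delta> by simp
        then have "2 * Re (Ginner G (u (k n)) v) \<le> \<omega> n + ?c" using main[of n] by linarith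
        moreover have "?\<phi> (x n) = Re (Ginner G (u (k n)) v) + Re (Ginner G (h n) v)"
          by (simp add: Rx h_def Gi.add_left)
        ultimately have "?\<phi> (x n) \<le> 3 / 4 * ?c" using elim pos by linarith
        then show ?case by simp
      qed
    qed
    then show False using pos by (simp add: v_def)
  qed
  then have vS: "v \<in> S" using S vD v_orth Av unfolding maximal_root_chain_def by blast
  \<comment> \<open>Membership of \<open>v\<close> in \<open>S\<close> kills both remaining terms of
    \<open>main\<close>: \<open>u (k n)\<close> and \<open>v\<close> are each orthogonal to
    \<open>S\<close>.\<close>
  have "\<delta> * (norm (R (x n) - v))\<^sup>2 \<le> \<omega> n" for n
    using main[of n] by (simp add: u(4)[OF vS] v_orth[OF vS])
  then have le: "(norm (R (x n) - v))\<^sup>2 \<le> \<omega> n / \<delta>" for n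
    using \<delta> by (simp add: field_simps)
  have "(\<lambda>n. \<omega> n / \<delta>) \<longlonglongrightarrow> 0"
    using tendsto_divide[OF \<omega> tendsto_const[of \<delta>]] \<delta> by simp
  then have "(\<lambda>n. (norm (R (x n) - v))\<^sup>2) \<longlonglongrightarrow> 0"
    by (rule Lim_null_comparison[rotated]) (use le in simp)
  then have "(\<lambda>n. R (x n) - v) \<longlonglongrightarrow> 0" by (simp add: tendsto_norm_zero_iff)
  from tendsto_diff[OF this h] have "(\<lambda>n. u (k n) - v) \<longlonglongrightarrow> 0" by (simp add: Rx h_def)
  then have "eventually (\<lambda>n. norm (u (k n) - v) < 1 / 2) sequentially"
    using order_tendstoD(2)[OF tendsto_norm_zero, of _ _ "1 / 2"] by simp
  then obtain n where "norm (u (k n) - v) < 1 / 2" unfolding eventually_sequentially by blast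
  \<comment> \<open>\<open>v\<close> lies in \<open>S\<close> and is orthogonal to \<open>S\<close>,
    so it is one of the isotropic vectors from which \<open>u n\<close> was required to keep its
    distance.\<close>
  moreover have "1 \<le> 2 * norm (u (k n) - v)" using u(5)[OF vS] v_orth by blast
  ultimately show False by simp
qed

text \<open>All hypotheses are homogeneous, so normalising \<open>u\<close> reduces this to unit
  vectors. Quasi-minimality is demanded only against the isotropic part of \<open>S\<close>:
  subtracting such a vector preserves orthogonality to \<open>S\<close>, subtracting a general
  element of \<open>S\<close> does not.\<close>

lemma maximal_root_chain_positive:
  assumes S: "maximal_root_chain S"
  obtains \<epsilon> where "\<epsilon> > 0"
    "\<And>u s. \<lbrakk>u \<in> D; s \<in> S; \<And>t. t \<in> S \<Longrightarrow> Ginner G u t = 0;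
      \<And>t. t \<in> S \<Longrightarrow> (\<And>t'. t' \<in> S \<Longrightarrow> Ginner G t t' = 0) \<Longrightarrow> norm u \<le> 2 * norm (u - t);
      norm (A u - l0 *\<^sub>C u - s) \<le> \<epsilon> * norm u\<rbrakk> \<Longrightarrow> \<epsilon> * (norm u)\<^sup>2 \<le> Re (Ginner G u u)"
proof -
  obtain \<epsilon> where \<epsilon>: "\<epsilon> > 0" "\<forall>u\<in>D. \<forall>s\<in>S. norm u = 1 \<longrightarrow> (\<forall>t\<in>S. Ginner G u t = 0) \<longrightarrow>
      (\<forall>t\<in>S. (\<forall>t'\<in>S. Ginner G t t' = 0) \<longrightarrow> 1 \<le> 2 * norm (u - t)) \<longrightarrow>
      norm (A u - l0 *\<^sub>C u - s) \<le> \<epsilon> \<longrightarrow> \<epsilon> \<le> Re (Ginner G u u)"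
    using maximal_root_chain_positive_unit[OF S] by blast
  have sub: "cvs.subspace S" using S root_chain_subspace by (simp add: maximal_root_chain_def)
  show ?thesis
  proof (rule that[OF \<epsilon>(1)])
    fix u s
    assume u: "u \<in> D" "s \<in> S" "\<And>t. t \<in> S \<Longrightarrow> Ginner G u t = 0"
      "\<And>t. t \<in> S \<Longrightarrow> (\<And>t'. t' \<in> S \<Longrightarrow> Ginner G t t' = 0) \<Longrightarrow> norm u \<le> 2 * norm (u - t)"
      "norm (A u - l0 *\<^sub>C u - s) \<le> \<epsilon> * norm u"
    show "\<epsilon> * (norm u)\<^sup>2 \<le> Re (Ginner G u u)"
    proof (cases "u = 0")
      case True
      then show ?thesis by (simp add: Gi.zero_left)
    next
      case False
      define c where "c = complex_of_real (1 / norm u)"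
      have c: "cmod c * norm u = 1" "c \<noteq> 0" "cmod c = 1 / norm u" using False by (auto simp: c_def norm_divide)
      have "1 \<le> 2 * norm (c *\<^sub>C u - t)" if t: "t \<in> S" "\<forall>t'\<in>S. Ginner G t t' = 0" for t
      proof -
        have "inverse c *\<^sub>C t \<in> S" using t(1) by (rule cvs.subspace_scale[OF sub])
        then have "norm u \<le> 2 * norm (u - inverse c *\<^sub>C t)"
          using t(2) by (intro u(4)) (auto simp: Ginner_scaleC_left[OF G])
        then have "cmod c * norm u \<le> 2 * norm (c *\<^sub>C (u - inverse c *\<^sub>C t))"
          unfolding norm_scaleC by (metis mult_left_mono norm_ge_zero mult.left_commute)
        also have "c *\<^sub>C (u - inverse c *\<^sub>C t) = c *\<^sub>C u - t"
          using c(2) by (simp add: cvs.scale_right_diff_distrib scaleC_scaleC scaleC_one)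
        finally show ?thesis using c by simp
      qed
      moreover have "norm (A (c *\<^sub>C u) - l0 *\<^sub>C (c *\<^sub>C u) - c *\<^sub>C s) \<le> \<epsilon>"
      proof -
        have "A (c *\<^sub>C u) - l0 *\<^sub>C (c *\<^sub>C u) - c *\<^sub>C s = c *\<^sub>C (A u - l0 *\<^sub>C u - s)"
          by (simp add: A_scaleC[OF u(1)] cvs.scale_right_diff_distrib scaleC_scaleC mult.commute)
        then have "norm (A (c *\<^sub>C u) - l0 *\<^sub>C (c *\<^sub>C u) - c *\<^sub>C s) = cmod c * norm (A u - l0 *\<^sub>C u - s)"
          by (simp only: norm_scaleC)
        also have "\<dots> \<le> cmod c * (\<epsilon> * norm u)" using u(5) by (intro mult_left_mono) auto
        finally show ?thesis using c(1) by (simp add: mult.left_commute)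
      qed
      moreover have "norm (c *\<^sub>C u) = 1" using c(1) by (simp only: norm_scaleC)
      moreover have "c *\<^sub>C u \<in> D" "c *\<^sub>C s \<in> S"
        using cvs.subspace_scale[OF D_subspace u(1)] cvs.subspace_scale[OF sub u(2)] by auto
      moreover have "\<forall>t\<in>S. Ginner G (c *\<^sub>C u) t = 0" using u(3) by (simp add: Ginner_scaleC_left[OF G])
      ultimately have "\<epsilon> \<le> Re (Ginner G (c *\<^sub>C u) (c *\<^sub>C u))" using \<epsilon>(2) by blast
      then show ?thesis unfolding Re_Ginner_scaleC[OF G] c(3) using False
        by (simp add: power_divide field_simps)
    qed
  qed
qed

section \<open>Resolvent growth\<close>

lemma Ginner_A: "u \<in> D \<Longrightarrow> v \<in> D \<Longrightarrow> Ginner G (A u) v = Ginner G u (A v)"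
  using G_symmetric by (simp add: G_symmetric_def)

lemma abs_Im_le: "\<bar>Im l\<bar> \<le> cmod (l - l0)"
proof -
  have "Im l0 = 0" using l0_real by (simp add: complex_eq_iff)
  then show ?thesis using abs_Im_le_cmod[of "l - l0"] by simp
qed

text \<open>A resolvent estimate on the companion of \<open>S\<close> modulo \<open>S\<close>; for
  \<open>S = {0}\<close> it is the ordinary one. The radius is a parameter because it stays fixed
  while the chain is dismantled, whereas \<open>M\<close> and \<open>m\<close> grow.\<close>

definition growth_bound :: "real \<Rightarrow> 'a set \<Rightarrow> bool" where
  "growth_bound r S \<longleftrightarrow> (\<exists>M>0. \<exists>m. \<forall>l. Im l \<noteq> 0 \<longrightarrow> cmod (l - l0) < r \<longrightarrow>
     (\<forall>u\<in>D. (\<forall>t\<in>S. Ginner G u t = 0) \<longrightarrow>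
       (\<forall>s\<in>S. \<exists>t\<in>S. \<bar>Im l\<bar> ^ m * norm (u - t) \<le> M * norm (A u - l *\<^sub>C u - s))))"

text \<open>Symmetry makes \<open>Ginner G (A u) u\<close> real, selfadjointness makes
  \<open>Ginner G u u\<close> real, and \<open>s\<close> does not contribute.\<close>

lemma Im_Ginner_residual:
  assumes u: "u \<in> D" "Ginner G s u = 0"
  shows "Im (Ginner G (A u - l *\<^sub>C u - s) u) = - Im l * Re (Ginner G u u)"
proof -
  have "Ginner G (A u) u = cnj (Ginner G (A u) u)"
    using Ginner_A[OF u(1) u(1)] Ginner_commute[OF G, of u "A u"] by simp
  then have 1: "Im (Ginner G (A u) u) = 0" by (simp add: complex_eq_iff)
  have "Ginner G u u = cnj (Ginner G u u)" by (rule Ginner_commute[OF G])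
  then have 2: "Im (Ginner G u u) = 0" by (simp add: complex_eq_iff)
  show ?thesis
    by (simp add: Gi.diff_left Ginner_scaleC_left[OF G] u(2) 1 2)
qed

text \<open>Dichotomy on the residual at \<open>l0\<close>. If it is small relative to the vector,
  positivity holds and the imaginary part of the form gives the bound with one power of
  \<open>Im l\<close>. If it is large, it is still large at the nearby \<open>l\<close>, which
  bounds the vector without any loss.\<close>

lemma growth_bound_maximal:
  assumes S: "maximal_root_chain S"
  shows "\<exists>r>0. r \<le> 1 \<and> growth_bound r S"
proof -
  have chain: "root_chain S" using S by (simp add: maximal_root_chain_def)
  note sub = root_chain_subspace[OF chain]
  obtain \<epsilon> where \<epsilon>: "\<epsilon> > 0"
    "\<And>u s. \<lbrakk>u \<in> D; s \<in> S; \<And>t. t \<in> S \<Longrightarrow> Ginner G u t = 0;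
      \<And>t. t \<in> S \<Longrightarrow> (\<And>t'. t' \<in> S \<Longrightarrow> Ginner G t t' = 0) \<Longrightarrow> norm u \<le> 2 * norm (u - t);
      norm (A u - l0 *\<^sub>C u - s) \<le> \<epsilon> * norm u\<rbrakk> \<Longrightarrow> \<epsilon> * (norm u)\<^sup>2 \<le> Re (Ginner G u u)"
    by (rule maximal_root_chain_positive[OF S]) blast
  obtain g where g: "g > 0" "\<And>x y. norm (Ginner G x y) \<le> norm x * norm y * g" using Gi.pos_bounded by blast
  \<comment> \<open>The isotropic part of \<open>S\<close>. Subtracting a quasi-nearest element of
    it makes \<open>u\<close> quasi-minimal while leaving it orthogonal to \<open>S\<close>.\<close>
  define Z where "Z = S \<inter> (\<Inter>t'\<in>S. {t. Ginner G t t' = 0})"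
  have "closed {t. Ginner G t t' = 0}" for t'
    using continuous_on_eq_continuous_within linear_continuous_on[OF Gi.bounded_linear_left[of t']]
    by (intro closed_Collect_eq continuous_on_const)
  then have Z_closed: "closed Z"
    unfolding Z_def by (intro closed_Int root_chain_closed[OF chain] closed_INT) auto
  have Z0: "0 \<in> Z" unfolding Z_def using cvs.subspace_0[OF sub] by (simp add: Gi.zero_left)
  \<comment> \<open>Half of \<epsilon> may be spent on moving from \<open>l0\<close> to
    \<open>l\<close>; the bound 1 ensures that powers of \<open>Im l\<close> only shrink.\<close>
  define r where "r = min (\<epsilon> / 2) 1"
  define M where "M = g / \<epsilon> + 2 / \<epsilon>"
  have M: "M > 0" "g / \<epsilon> \<le> M" "2 / \<epsilon> \<le> M" using \<epsilon>(1) g(1) by (auto simp: M_def intro!: add_pos_pos)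
  have "\<exists>t\<in>S. \<bar>Im l\<bar> ^ 1 * norm (u - t) \<le> M * norm (A u - l *\<^sub>C u - s)"
    if l: "Im l \<noteq> 0" "cmod (l - l0) < r" and u: "u \<in> D" "\<forall>t\<in>S. Ginner G u t = 0" and s: "s \<in> S" for l u s
  proof -
    obtain t where t: "t \<in> Z" "\<forall>t'\<in>Z. norm (u - t) \<le> 2 * norm (u - t')"
      using exists_quasi_nearest[OF Z_closed] Z0 by blast
    have tS: "t \<in> S" and t0: "\<And>t'. t' \<in> S \<Longrightarrow> Ginner G t t' = 0" using t(1) by (auto simp: Z_def)
    define u1 where "u1 = u - t"
    define s1 where "s1 = s - (A t - l *\<^sub>C t)"
    define f where "f = A u - l *\<^sub>C u - s"
    have tD: "t \<in> D" using tS root_chain_domain[OF chain] by blast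
    have u1D: "u1 \<in> D" unfolding u1_def by (rule cvs.subspace_diff[OF D_subspace u(1) tD])
    have s1S: "s1 \<in> S" unfolding s1_def
      by (rule cvs.subspace_diff[OF sub s root_chain_invariant'[OF chain tS]])
    have f: "f = A u1 - l *\<^sub>C u1 - s1"
      by (simp add: f_def u1_def s1_def A_diff u(1) tD cvs.scale_right_diff_distrib)
    have orth: "Ginner G u1 t' = 0" if "t' \<in> S" for t'
      using u(2) t0[OF that] that by (simp add: u1_def Gi.diff_left)
    have near: "norm u1 \<le> 2 * norm (u1 - t')" if "t' \<in> S" "\<And>t''. t'' \<in> S \<Longrightarrow> Ginner G t' t'' = 0" for t'
    proof -
      have "t + t' \<in> Z" unfolding Z_def
        using that t0 cvs.subspace_add[OF sub tS that(1)] by (auto simp: Gi.add_left)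
      then show ?thesis using t(2) by (simp add: u1_def diff_diff_eq)
    qed
    have y1: "\<bar>Im l\<bar> \<le> 1" using abs_Im_le[of l] l(2) by (simp add: r_def)
    have "\<bar>Im l\<bar> * norm u1 \<le> M * norm f"
    proof (cases "norm (A u1 - l0 *\<^sub>C u1 - s1) \<le> \<epsilon> * norm u1")
      case True
      have "\<epsilon> * (norm u1)\<^sup>2 \<le> Re (Ginner G u1 u1)" by (rule \<epsilon>(2)[OF u1D s1S orth near True])
      then have "\<bar>Im l\<bar> * (\<epsilon> * (norm u1)\<^sup>2) \<le> \<bar>Im l\<bar> * \<bar>Re (Ginner G u1 u1)\<bar>"
        by (intro mult_left_mono) auto
      also have "\<dots> = \<bar>Im (Ginner G f u1)\<bar>"
        unfolding f using orth[OF s1S] Ginner_commute[OF G, of s1 u1]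
        by (subst Im_Ginner_residual[OF u1D]) (auto simp: abs_mult)
      also have "\<dots> \<le> norm f * norm u1 * g" using abs_Im_le_cmod g(2) order_trans by blast
      finally have "norm u1 * (\<bar>Im l\<bar> * norm u1 * \<epsilon>) \<le> norm u1 * (norm f * g)"
        by (simp add: power2_eq_square mult_ac)
      then have "\<bar>Im l\<bar> * norm u1 * \<epsilon> \<le> norm f * g" if "u1 \<noteq> 0" using that by simp
      moreover have "\<bar>Im l\<bar> * norm u1 * \<epsilon> \<le> norm f * g" if "u1 = 0" using that g(1) by simp
      ultimately have "\<bar>Im l\<bar> * norm u1 \<le> g / \<epsilon> * norm f" using \<epsilon>(1) by (cases "u1 = 0") (simp_all add: field_simps)
      also have "\<dots> \<le> M * norm f" using M by (intro mult_right_mono) auto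
      finally show ?thesis .
    next
      case False
      have "A u1 - l0 *\<^sub>C u1 - s1 = f + (l - l0) *\<^sub>C u1" by (simp add: f cvs.scale_left_diff_distrib)
      then have "norm (A u1 - l0 *\<^sub>C u1 - s1) \<le> norm f + cmod (l - l0) * norm u1"
        using norm_triangle_ineq[of f "(l - l0) *\<^sub>C u1"] by (simp add: norm_scaleC)
      moreover have "cmod (l - l0) * norm u1 \<le> \<epsilon> / 2 * norm u1"
        using l(2) by (intro mult_right_mono) (auto simp: r_def)
      ultimately have "\<epsilon> / 2 * norm u1 \<le> norm f" using False by (simp add: field_simps)
      then have "norm u1 \<le> 2 / \<epsilon> * norm f" using \<epsilon>(1) by (simp add: field_simps)
      also have "\<dots> \<le> M * norm f" using M by (intro mult_right_mono) auto
      finally show ?thesis using mult_right_mono[OF y1, of "norm u1"] by simp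
    qed
    then show ?thesis using tS by (intro bexI[of _ t]) (simp_all add: u1_def f_def)
  qed
  then have "growth_bound r S" unfolding growth_bound_def using M(1) by blast
  then show ?thesis using \<epsilon>(1) by (intro exI[of _ r]) (auto simp: r_def)
qed

text \<open>Pairing \<open>(A - l) u = f + s\<close> with \<open>v\<close> shows that \<open>Ginner G u v\<close> is at most of order
  \<open>norm f / cmod (l - l0)\<close>, so a multiple of a fixed vector moves \<open>u\<close> into the orthogonal companion of
  \<open>extend v S\<close>. Applying \<open>R\<close> then bounds the \<open>v\<close>-coefficient of the approximating element. Each
  of the two corrections costs one power of \<open>Im l\<close>.\<close>

lemma growth_bound_remove:
  assumes chain: "root_chain S" and v: "v \<in> D" "v \<notin> S" "\<And>s. s \<in> S \<Longrightarrow> Ginner G v s = 0"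
      "A v - l0 *\<^sub>C v \<in> S"
    and r: "r \<le> 1" and bound: "growth_bound r (extend v S)"
  shows "growth_bound r S"
proof -
  note sub = root_chain_subspace[OF chain]
  obtain M m where M: "M > 0" and Mm: "\<And>l u s. \<lbrakk>Im l \<noteq> 0; cmod (l - l0) < r; u \<in> D;
      \<forall>t\<in>extend v S. Ginner G u t = 0; s \<in> extend v S\<rbrakk> \<Longrightarrow>
      \<exists>t\<in>extend v S. \<bar>Im l\<bar> ^ m * norm (u - t) \<le> M * norm (A u - l *\<^sub>C u - s)"
    using bound unfolding growth_bound_def by metis
  \<comment> \<open>A dual vector for \<open>v\<close> in the companion of \<open>S\<close>, scaled
    to \<open>Ginner G w v = 1\<close>. If none exists, every \<open>u\<close> of the companion is
    already orthogonal to \<open>v\<close> and \<open>w = 0\<close> serves; the product equation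
    covers both cases.\<close>
  obtain w where w: "w \<in> D" "\<And>t. t \<in> S \<Longrightarrow> Ginner G w t = 0"
    "\<And>u. u \<in> D \<Longrightarrow> \<forall>t\<in>S. Ginner G u t = 0 \<Longrightarrow> Ginner G u v * Ginner G w v = Ginner G u v"
  proof (cases "\<exists>w\<in>D. (\<forall>t\<in>S. Ginner G w t = 0) \<and> Ginner G w v \<noteq> 0")
    case True
    then obtain w where w: "w \<in> D" "\<forall>t\<in>S. Ginner G w t = 0" "Ginner G w v \<noteq> 0" by blast
    show ?thesis
      by (rule that[of "inverse (Ginner G w v) *\<^sub>C w"])
        (use w cvs.subspace_scale[OF D_subspace w(1)] in \<open>simp_all add: Ginner_scaleC_left[OF G]\<close>)
  next
    case False
    then show ?thesis
      by (intro that[of 0]) (auto simp: cvs.subspace_0[OF D_subspace] Gi.zero_left)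
  qed
  obtain K where K: "K > 0" "\<And>x. norm (R x) \<le> norm x * K" using R.pos_bounded by blast
  obtain g where g: "g > 0" "\<And>x y. norm (Ginner G x y) \<le> norm x * norm y * g" using Gi.pos_bounded by blast
  obtain d where d: "d > 0" "\<And>c s. s \<in> S \<Longrightarrow> d * cmod c \<le> norm (c *\<^sub>C v + s)"
    by (rule coefficient_bound[OF sub root_chain_closed[OF chain] v(2)]) blast
  define \<rho> where "\<rho> = cmod (l1 - l0)"
  have \<rho>: "\<rho> > 0" using l1_ne by (simp add: \<rho>_def)
  define e where "e = inverse (l0 - l1)"
  have e: "cmod e = 1 / \<rho>"
    by (simp add: e_def \<rho>_def norm_inverse norm_minus_commute divide_inverse)
  define \<kappa> where "\<kappa> = norm (A w - l0 *\<^sub>C w) + norm w"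
  have \<kappa>: "\<kappa> \<ge> 0" by (simp add: \<kappa>_def)
  \<comment> \<open>\<open>N1\<close> controls the residual after making \<open>u\<close> orthogonal
    to \<open>v\<close>, \<open>N2\<close> the distance to \<open>extend v S\<close>, and
    \<open>N3 / d\<close> the \<open>v\<close>-coefficient that must finally be dropped.\<close>
  define N1 where "N1 = 1 + g * norm v * \<kappa>"
  define N2 where "N2 = M * N1 + g * norm v * norm w"
  define N3 where "N3 = \<rho> * (K + (1 + (\<rho> + 1) * K) * N2)"
  have N: "N1 \<ge> 0" "N2 \<ge> 0" "N3 \<ge> 0"
    using g(1) \<kappa> M K(1) \<rho> by (auto simp: N1_def N2_def N3_def intro!: add_nonneg_nonneg mult_nonneg_nonneg)
  define M' where "M' = 1 + N2 + N3 / d * norm v"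
  have M': "M' > 0" using N d(1) unfolding M'_def by (intro add_pos_nonneg) auto
  have "\<exists>t\<in>S. \<bar>Im l\<bar> ^ (m + 2) * norm (u - t) \<le> M' * norm (A u - l *\<^sub>C u - s)"
    if l: "Im l \<noteq> 0" "cmod (l - l0) < r" and u: "u \<in> D" "\<forall>t\<in>S. Ginner G u t = 0" and s: "s \<in> S" for l u s
  proof -
    define y where "y = \<bar>Im l\<bar>"
    have yl: "y \<le> cmod (l - l0)" unfolding y_def by (rule abs_Im_le)
    have l1': "cmod (l - l0) \<le> 1" using l(2) r by linarith
    have y: "0 < y" "y \<le> 1" using l(1) yl l1' by (auto simp: y_def)
    define f where "f = A u - l *\<^sub>C u - s"
    define \<alpha> where "\<alpha> = Ginner G u v"
    define s' where "s' = A v - l0 *\<^sub>C v"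
    have s': "s' \<in> S" "A v = l0 *\<^sub>C v + s'" using v(4) by (auto simp: s'_def)
    \<comment> \<open>By symmetry \<open>A\<close> moves onto \<open>v\<close>, where it acts as the
      real number \<open>l0\<close> up to an element of \<open>S\<close>, to which \<open>u\<close>
      is orthogonal.\<close>
    have "Ginner G f v = (l0 - l) * \<alpha>"
    proof -
      have "Ginner G (A u) v = l0 * \<alpha>"
        unfolding Ginner_A[OF u(1) v(1)] s'(2) Gi.add_right Ginner_scaleC_right
        using u(2) s'(1) by (simp add: l0_real \<alpha>_def)
      moreover have "Ginner G s v = 0" using Ginner_commute[OF G, of s v] v(3)[OF s] by simp
      ultimately show ?thesis
        by (simp add: f_def Gi.diff_left Ginner_scaleC_left[OF G] \<alpha>_def left_diff_distrib)
    qed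
    then have "cmod (l0 - l) * cmod \<alpha> \<le> norm f * norm v * g" using g(2)[of f v] by (simp add: norm_mult)
    then have \<alpha>: "y * cmod \<alpha> \<le> g * norm v * norm f"
      using mult_right_mono[OF yl, of "cmod \<alpha>"] by (simp add: norm_minus_commute mult_ac)
    define u' where "u' = u - \<alpha> *\<^sub>C w"
    have \<alpha>w: "\<alpha> *\<^sub>C w \<in> D" by (rule cvs.subspace_scale[OF D_subspace w(1)])
    have u'D: "u' \<in> D" unfolding u'_def by (rule cvs.subspace_diff[OF D_subspace u(1) \<alpha>w])
    have u'S: "Ginner G u' t = 0" if "t \<in> S" for t
      using u(2) w(2)[OF that] that by (simp add: u'_def Gi.diff_left Ginner_scaleC_left[OF G])
    have u'v: "Ginner G u' v = 0"
      using w(3)[OF u] by (simp add: u'_def Gi.diff_left Ginner_scaleC_left[OF G] \<alpha>_def)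
    have u'_orth: "\<forall>t\<in>extend v S. Ginner G u' t = 0"
    proof
      fix t assume "t \<in> extend v S"
      then obtain c t' where "t = c *\<^sub>C v + t'" "t' \<in> S" unfolding extend_def by blast
      then show "Ginner G u' t = 0" by (simp add: Gi.add_right Ginner_scaleC_right u'v u'S)
    qed
    have "\<exists>t\<in>extend v S. \<bar>Im l\<bar> ^ m * norm (u' - t) \<le> M * norm (A u' - l *\<^sub>C u' - s)"
      by (rule Mm[OF l u'D u'_orth]) (use s subset_extend in blast)
    then obtain c t where t: "t \<in> S" and
        ct: "y ^ m * norm (u' - (c *\<^sub>C v + t)) \<le> M * norm (A u' - l *\<^sub>C u' - s)"
      unfolding extend_def y_def by blast
    have "A u' - l *\<^sub>C u' - s = f - \<alpha> *\<^sub>C (A w - l *\<^sub>C w)"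
      by (simp add: f_def u'_def A_diff u(1) \<alpha>w A_scaleC w(1) cvs.scale_right_diff_distrib scaleC_scaleC mult.commute)
    then have "norm (A u' - l *\<^sub>C u' - s) \<le> norm f + cmod \<alpha> * norm (A w - l *\<^sub>C w)"
      using norm_triangle_ineq4[of f "\<alpha> *\<^sub>C (A w - l *\<^sub>C w)"] by (simp add: norm_scaleC)
    moreover have "norm (A w - l *\<^sub>C w) \<le> \<kappa>"
    proof -
      have "A w - l *\<^sub>C w = (A w - l0 *\<^sub>C w) - (l - l0) *\<^sub>C w" by (simp add: cvs.scale_left_diff_distrib)
      then have "norm (A w - l *\<^sub>C w) \<le> norm (A w - l0 *\<^sub>C w) + cmod (l - l0) * norm w"
        using norm_triangle_ineq4[of "A w - l0 *\<^sub>C w" "(l - l0) *\<^sub>C w"] by (simp only: norm_scaleC)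
      then show ?thesis using mult_right_mono[OF l1', of "norm w"] by (simp add: \<kappa>_def)
    qed
    ultimately have "norm (A u' - l *\<^sub>C u' - s) \<le> norm f + cmod \<alpha> * \<kappa>"
      using mult_left_mono[of "norm (A w - l *\<^sub>C w)" \<kappa> "cmod \<alpha>"] by (smt (verit) norm_ge_zero)
    then have "y * norm (A u' - l *\<^sub>C u' - s) \<le> y * norm f + y * cmod \<alpha> * \<kappa>"
      using mult_left_mono[of _ _ y] y(1) by (simp add: distrib_left[symmetric] mult.assoc)
    also have "\<dots> \<le> norm f + (g * norm v * norm f) * \<kappa>"
      using y by (intro add_mono mult_right_mono \<alpha> \<kappa> mult_left_le_one_le) auto
    finally have f': "y * norm (A u' - l *\<^sub>C u' - s) \<le> N1 * norm f" by (simp add: N1_def algebra_simps)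
    \<comment> \<open>The additional factor \<open>y\<close> in the estimate of \<open>z\<close>
      pays for the correction by \<open>\<alpha> *\<^sub>C w\<close>. It remains to discard
      \<open>c *\<^sub>C v\<close>, since only elements of \<open>S\<close> may be
      subtracted.\<close>
    define z where "z = u - (c *\<^sub>C v + t)"
    have z_eq: "z = (u' - (c *\<^sub>C v + t)) + \<alpha> *\<^sub>C w" by (simp add: z_def u'_def)
    have "y ^ (m + 1) * norm z \<le> y ^ (m + 1) * (norm (u' - (c *\<^sub>C v + t)) + cmod \<alpha> * norm w)"
      unfolding z_eq using norm_triangle_ineq[of "u' - (c *\<^sub>C v + t)" "\<alpha> *\<^sub>C w"] y(1)
      by (intro mult_left_mono) (auto simp: norm_scaleC)
    also have "\<dots> = y * (y ^ m * norm (u' - (c *\<^sub>C v + t))) + y ^ m * (y * cmod \<alpha> * norm w)"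
      by (simp add: algebra_simps)
    also have "\<dots> \<le> y * (M * norm (A u' - l *\<^sub>C u' - s)) + 1 * ((g * norm v * norm f) * norm w)"
      using y g(1) by (intro add_mono mult_mono mult_right_mono \<alpha> ct power_le_one) auto
    also have "\<dots> \<le> M * (N1 * norm f) + (g * norm v * norm f) * norm w"
      using mult_left_mono[OF f', of M] M by (simp add: mult.left_commute)
    finally have z: "y ^ (m + 1) * norm z \<le> N2 * norm f" by (simp add: N2_def algebra_simps)
    have zD: "z \<in> D" and tD: "t \<in> D"
      using t root_chain_domain[OF chain] v(1) u(1) unfolding z_def
      by (auto intro!: cvs.subspace_diff[OF D_subspace] cvs.subspace_add[OF D_subspace] cvs.subspace_scale[OF D_subspace])
    \<comment> \<open>Collects all terms of \<open>(A - l1) z\<close> in \<open>S\<close>; what is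
      left consists of \<open>f\<close>, \<open>z\<close> and the multiple
      \<open>c * (l0 - l)\<close> of \<open>v\<close>.\<close>
    define s2 where "s2 = s - (A t - l *\<^sub>C t) - c *\<^sub>C s'"
    have s2: "s2 \<in> S" unfolding s2_def
      by (intro cvs.subspace_diff[OF sub] cvs.subspace_scale[OF sub] s s' root_chain_invariant'[OF chain t])
    define s3 where "s3 = R v - e *\<^sub>C v"
    have s3: "s3 \<in> S" unfolding s3_def e_def
      by (rule root_chain_resolvent_mod[OF root_chain_resolvent[OF chain] sub v(1,4) mem_extend_self[OF sub]])
    have "A z = A u - (c *\<^sub>C A v + A t)"
      unfolding z_def using v(1) tD u(1)
      by (simp add: A_diff A_add A_scaleC cvs.subspace_add[OF D_subspace] cvs.subspace_scale[OF D_subspace])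
    then have "A z - l1 *\<^sub>C z = f + s2 - (c * (l0 - l)) *\<^sub>C v - (l1 - l) *\<^sub>C z"
      unfolding s'(2) f_def s2_def
      by (simp add: z_def scaleC_add_right cvs.scale_right_diff_distrib cvs.scale_left_diff_distrib
          scaleC_scaleC algebra_simps)
    then have "R (A z - l1 *\<^sub>C z) = R (f + s2 - (c * (l0 - l)) *\<^sub>C v - (l1 - l) *\<^sub>C z)" by (rule arg_cong)
    then have z1: "z = R f + R s2 - (c * (l0 - l)) *\<^sub>C R v - (l1 - l) *\<^sub>C R z"
      unfolding R_left[OF zD] by (simp only: R.add R.diff R_scaleC)
    have Rv: "(c * (l0 - l)) *\<^sub>C R v = (c * (l0 - l) * e) *\<^sub>C v + (c * (l0 - l)) *\<^sub>C s3"
      unfolding s3_def by (simp add: cvs.scale_right_diff_distrib scaleC_scaleC)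
    \<comment> \<open>\<open>A z\<close> cannot be bounded by the norm of \<open>z\<close>, so
      \<open>R\<close> is applied first. It acts on \<open>v\<close> as \<open>e\<close> modulo
      \<open>S\<close>, hence the \<open>v\<close>-coefficient survives and \<open>d\<close> bounds
      it; dividing by \<open>l0 - l\<close> costs the second power.\<close>
    have eq: "(c * (l0 - l) * e) *\<^sub>C v + ((c * (l0 - l)) *\<^sub>C s3 - R s2) = R f - z - (l1 - l) *\<^sub>C R z"
    proof -
      have "P + (Q - b) = a - x - Y" if "x = a + b - X - Y" "X = P + Q" for x a b X Y P Q :: 'a
        unfolding that by simp
      then show ?thesis using z1 Rv by blast
    qed
    have "(c * (l0 - l)) *\<^sub>C s3 - R s2 \<in> S"
      by (intro cvs.subspace_diff[OF sub] cvs.subspace_scale[OF sub] s3 root_chain_resolvent[OF chain s2])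
    from d(2)[OF this, of "c * (l0 - l) * e"]
    have "d * cmod (c * (l0 - l) * e) \<le> norm (R f - z - (l1 - l) *\<^sub>C R z)" unfolding eq .
    also have "\<dots> \<le> norm (R f) + norm z + cmod (l1 - l) * norm (R z)"
      using norm_triangle_ineq4[of "R f - z" "(l1 - l) *\<^sub>C R z"] norm_triangle_ineq4[of "R f" z]
      by (simp add: norm_scaleC)
    also have "\<dots> \<le> norm f * K + norm z + (\<rho> + 1) * (norm z * K)"
    proof -
      have "cmod (l1 - l) \<le> \<rho> + 1"
        using norm_triangle_ineq4[of "l1 - l0" "l - l0"] l1' by (simp add: \<rho>_def)
      then show ?thesis using \<rho> by (intro add_mono mult_mono K(2)) auto
    qed
    also have "\<dots> = K * norm f + (1 + (\<rho> + 1) * K) * norm z" by (simp add: algebra_simps)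
    finally have "\<rho> * (d * cmod (c * (l0 - l) * e)) \<le> \<rho> * (K * norm f + (1 + (\<rho> + 1) * K) * norm z)"
      using \<rho> by (intro mult_left_mono) auto
    moreover have "\<rho> * (d * cmod (c * (l0 - l) * e)) = d * (cmod c * cmod (l - l0))"
      unfolding norm_mult e norm_minus_commute[of l l0] using \<rho> by simp
    moreover have "d * (cmod c * y) \<le> d * (cmod c * cmod (l - l0))"
      using d(1) yl by (intro mult_left_mono) auto
    ultimately have c1: "d * (cmod c * y) \<le> \<rho> * (K * norm f + (1 + (\<rho> + 1) * K) * norm z)" by linarith
    have "d * (y ^ (m + 2) * cmod c) = y ^ (m + 1) * (d * (cmod c * y))" by (simp add: mult_ac)
    also have "\<dots> \<le> y ^ (m + 1) * (\<rho> * (K * norm f + (1 + (\<rho> + 1) * K) * norm z))"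
      using c1 y(1) by (intro mult_left_mono) auto
    also have "\<dots> = \<rho> * (y ^ (m + 1) * (K * norm f) + (1 + (\<rho> + 1) * K) * (y ^ (m + 1) * norm z))"
      by (simp add: algebra_simps)
    also have "\<dots> \<le> \<rho> * (1 * (K * norm f) + (1 + (\<rho> + 1) * K) * (N2 * norm f))"
      using \<rho> K(1) y by (intro mult_left_mono add_mono mult_right_mono power_le_one z) auto
    also have "\<dots> = N3 * norm f" by (simp add: N3_def algebra_simps)
    finally have c2: "y ^ (m + 2) * cmod c \<le> N3 / d * norm f" using d(1) by (simp add: field_simps)
    have "u - t = z + c *\<^sub>C v" by (simp add: z_def)
    then have "norm (u - t) \<le> norm z + cmod c * norm v"
      using norm_triangle_ineq[of z "c *\<^sub>C v"] by (simp add: norm_scaleC)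
    then have "y ^ (m + 2) * norm (u - t) \<le> y ^ (m + 2) * (norm z + cmod c * norm v)"
      using y(1) by (intro mult_left_mono) auto
    also have "\<dots> = y * (y ^ (m + 1) * norm z) + (y ^ (m + 2) * cmod c) * norm v"
      by (simp add: algebra_simps)
    also have "\<dots> \<le> 1 * (N2 * norm f) + (N3 / d * norm f) * norm v"
      using y N(2) by (intro add_mono mult_mono mult_right_mono z c2) auto
    also have "\<dots> \<le> M' * norm f" by (simp add: M'_def algebra_simps)
    finally show ?thesis using t unfolding y_def f_def by blast
  qed
  then show ?thesis unfolding growth_bound_def using M' by blast
qed

lemma growth_bound_zero: "root_chain S \<Longrightarrow> r \<le> 1 \<Longrightarrow> growth_bound r S \<Longrightarrow> growth_bound r {0}"
proof (induction rule: root_chain.induct)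
  case zero
  then show ?case by simp
next
  case (extend S v)
  then show ?case using growth_bound_remove[of S v r] by blast
qed

lemma local_estimate:
  "\<exists>r>0. r \<le> 1 \<and> (\<exists>M>0. \<exists>m. \<forall>l. Im l \<noteq> 0 \<longrightarrow> cmod (l - l0) < r \<longrightarrow>
     (\<forall>u\<in>D. \<bar>Im l\<bar> ^ m * norm u \<le> M * norm (A u - l *\<^sub>C u)))"
proof -
  obtain S where S: "maximal_root_chain S" using exists_maximal_root_chain by blast
  then obtain r where r: "r > 0" "r \<le> 1" "growth_bound r S" using growth_bound_maximal by blast
  have "growth_bound r {0}"
    using growth_bound_zero[OF _ r(2,3)] S unfolding maximal_root_chain_def by blast
  then have "\<exists>M>0. \<exists>m. \<forall>l. Im l \<noteq> 0 \<longrightarrow> cmod (l - l0) < r \<longrightarrow>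
     (\<forall>u\<in>D. \<bar>Im l\<bar> ^ m * norm u \<le> M * norm (A u - l *\<^sub>C u))"
    unfolding growth_bound_def by (simp add: Gi.zero_right)
  then show ?thesis using r(1,2) by blast
qed

end

section \<open>From the sequential definition of the spectral type to the local estimate\<close>

text \<open>A sequence of unit vectors violating uniform positivity would be an approximate
  eigensequence in \<open>L\<close> with limit inferior at most 0. The \<open>C\<close>-term extends
  the inequality to vectors whose residual is not small.\<close>

lemma quantitative_positivity:
  assumes G: "bounded_selfadjoint G" and A: "linear_operator D A" and L: "cvs.subspace L"
    and pos: "\<And>x. approx_eigenseq D A l x \<Longrightarrow> (\<And>n. x n \<in> L) \<Longrightarrow>
        liminf (\<lambda>n. ereal (Re (Ginner G (x n) (x n)))) > 0"
  obtains \<delta> C where "\<delta> > 0" "C > 0"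
    "\<And>x. x \<in> D \<Longrightarrow> x \<in> L \<Longrightarrow> \<delta> * (norm x)\<^sup>2 \<le> Re (Ginner G x x) + C * (norm (A x - l *\<^sub>C x))\<^sup>2"
proof -
  interpret Gi: bounded_bilinear "Ginner G" by (rule bounded_bilinear_Ginner[OF G])
  have D: "cvs.subspace D" and A_scaleC: "\<And>c x. x \<in> D \<Longrightarrow> A (c *\<^sub>C x) = c *\<^sub>C A x"
    using A by (auto simp: linear_operator_def)
  obtain g where g: "g > 0" "\<And>x y. norm (Ginner G x y) \<le> norm x * norm y * g" using Gi.pos_bounded by blast
  have "\<exists>\<epsilon>>0. \<forall>x\<in>D. x \<in> L \<longrightarrow> norm x = 1 \<longrightarrow> norm (A x - l *\<^sub>C x) \<le> \<epsilon> \<longrightarrow> \<epsilon> \<le> Re (Ginner G x x)"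
  proof (rule ccontr)
    assume no: "\<not> ?thesis"
    have "\<exists>x. x \<in> D \<and> x \<in> L \<and> norm x = 1 \<and> norm (A x - l *\<^sub>C x) \<le> inverse (Suc n) \<and>
        Re (Ginner G x x) < inverse (Suc n)" for n
    proof -
      have "inverse (real (Suc n)) > 0" by simp
      then show ?thesis using no not_le by metis
    qed
    then obtain x where x: "\<And>n. x n \<in> D" "\<And>n. x n \<in> L" "\<And>n. norm (x n) = 1"
        "\<And>n. norm (A (x n) - l *\<^sub>C x n) \<le> inverse (Suc n)"
        "\<And>n. Re (Ginner G (x n) (x n)) < inverse (Suc n)" by metis
    have "(\<lambda>n. A (x n) - l *\<^sub>C x n) \<longlonglongrightarrow> 0"
      by (rule Lim_null_comparison[OF _ LIMSEQ_inverse_real_of_nat]) (use x(4) in simp)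
    then have "approx_eigenseq D A l x" using x by (simp add: approx_eigenseq_def)
    then have "liminf (\<lambda>n. ereal (Re (Ginner G (x n) (x n)))) > 0" using x(2) by (rule pos)
    moreover have "liminf (\<lambda>n. ereal (Re (Ginner G (x n) (x n)))) \<le> liminf (\<lambda>n. ereal (inverse (real (Suc n))))"
      by (rule Liminf_mono) (use x(5) in \<open>simp add: less_imp_le\<close>)
    moreover have "liminf (\<lambda>n. ereal (inverse (real (Suc n)))) = ereal 0"
      by (intro lim_imp_Liminf) (use LIMSEQ_inverse_real_of_nat in \<open>simp_all only: lim_ereal trivial_limit_sequentially not_False_eq_True\<close>)
    ultimately show False unfolding zero_ereal_def by (simp only: not_le[symmetric])
  qed
  then obtain \<epsilon> where \<epsilon>: "\<epsilon> > 0" "\<And>x. \<lbrakk>x \<in> D; x \<in> L; norm x = 1; norm (A x - l *\<^sub>C x) \<le> \<epsilon>\<rbrakk> \<Longrightarrow> \<epsilon> \<le> Re (Ginner G x x)"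
    by metis
  \<comment> \<open>Chosen so that \<open>C * \<epsilon>^2 = g + \<epsilon>\<close>: when the
    residual exceeds \<open>\<epsilon> * norm x\<close>, the \<open>C\<close>-term outweighs the
    worst negative value \<open>- g * (norm x)^2\<close> of the form and leaves \<epsilon> to
    spare.\<close>
  define C where "C = (g + \<epsilon>) / \<epsilon>\<^sup>2"
  have C: "C > 0" using \<epsilon> g by (simp add: C_def)
  have "\<epsilon> * (norm x)\<^sup>2 \<le> Re (Ginner G x x) + C * (norm (A x - l *\<^sub>C x))\<^sup>2" if x: "x \<in> D" "x \<in> L" for x
  proof (cases "norm (A x - l *\<^sub>C x) \<le> \<epsilon> * norm x")
    case True
    have "\<epsilon> * (norm x)\<^sup>2 \<le> Re (Ginner G x x)"
    proof (cases "x = 0")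
      case True
      then show ?thesis by (simp add: Gi.zero_left)
    next
      case False
      define c where "c = complex_of_real (1 / norm x)"
      have c: "cmod c = 1 / norm x" "cmod c * norm x = 1" using False by (auto simp: c_def norm_divide)
      have "A (c *\<^sub>C x) - l *\<^sub>C (c *\<^sub>C x) = c *\<^sub>C (A x - l *\<^sub>C x)"
        by (simp add: A_scaleC[OF x(1)] cvs.scale_right_diff_distrib scaleC_scaleC mult.commute)
      then have "norm (A (c *\<^sub>C x) - l *\<^sub>C (c *\<^sub>C x)) = cmod c * norm (A x - l *\<^sub>C x)" by (simp only: norm_scaleC)
      also have "\<dots> \<le> cmod c * (\<epsilon> * norm x)" using True by (intro mult_left_mono) auto
      also have "\<dots> = \<epsilon>" using c(2) by (simp add: mult.left_commute)
      finally have "\<epsilon> \<le> Re (Ginner G (c *\<^sub>C x) (c *\<^sub>C x))"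
        using c(2) by (intro \<epsilon>(2) cvs.subspace_scale[OF D x(1)] cvs.subspace_scale[OF L x(2)])
          (simp_all add: norm_scaleC)
      then show ?thesis unfolding Re_Ginner_scaleC[OF G] c(1) using False
        by (simp add: power_divide field_simps)
    qed
    then show ?thesis using C by (simp add: add_increasing2)
  next
    case False
    have "- (norm x * norm x * g) \<le> Re (Ginner G x x)"
      using g(2)[of x x] abs_Re_le_cmod[of "Ginner G x x"] by linarith
    moreover have "(\<epsilon> * norm x)\<^sup>2 \<le> (norm (A x - l *\<^sub>C x))\<^sup>2"
      using False \<epsilon>(1) by (intro power_mono) auto
    then have "C * (\<epsilon> * norm x)\<^sup>2 \<le> C * (norm (A x - l *\<^sub>C x))\<^sup>2" using C by (intro mult_left_mono) auto
    moreover have "C * (\<epsilon> * norm x)\<^sup>2 = (g + \<epsilon>) * (norm x)\<^sup>2"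
      using \<epsilon>(1) by (simp add: C_def power_mult_distrib)
    ultimately show ?thesis by (simp add: power2_eq_square algebra_simps)
  qed
  then show ?thesis using that[OF \<epsilon>(1) C] by blast
qed

text \<open>Builds the data of the locale: first \<delta> and \<open>C\<close> at the real point,
  then \<open>l1\<close> on the vertical line through it, near enough for these constants and inside
  \<open>U\<close>.\<close>

lemma local_growth:
  assumes G: "bounded_selfadjoint G" and A: "linear_operator D A" and sym: "G_symmetric G D A"
    and U: "open U" "complex_of_real t \<in> U" "U - \<real> \<subseteq> resolvent_set D A"
    and L: "cvs.subspace L" "finite_codim L"
    and pos: "\<And>x. approx_eigenseq D A (complex_of_real t) x \<Longrightarrow> (\<And>n. x n \<in> L) \<Longrightarrow>
        liminf (\<lambda>n. ereal (Re (Ginner G (x n) (x n)))) > 0"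
  shows "\<exists>r>0. r \<le> 1 \<and> (\<exists>M>0. \<exists>m. \<forall>l. Im l \<noteq> 0 \<longrightarrow> cmod (l - complex_of_real t) < r \<longrightarrow>
     (\<forall>u\<in>D. \<bar>Im l\<bar> ^ m * norm u \<le> M * norm (A u - l *\<^sub>C u)))"
proof -
  let ?l0 = "complex_of_real t"
  interpret Gi: bounded_bilinear "Ginner G" by (rule bounded_bilinear_Ginner[OF G])
  obtain \<delta> C where \<delta>: "\<delta> > 0" and C: "C > 0"
    and ineq: "\<And>x. x \<in> D \<Longrightarrow> x \<in> L \<Longrightarrow>
        \<delta> * (norm x)\<^sup>2 \<le> Re (Ginner G x x) + C * (norm (A x - ?l0 *\<^sub>C x))\<^sup>2"
    by (rule quantitative_positivity[OF G A L(1) pos]) blast+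
  obtain r where r: "r > 0" "ball ?l0 r \<subseteq> U" using U(1,2) open_contains_ball by blast
  \<comment> \<open>The constant 2000 in place of 1000 makes the required inequality strict.\<close>
  define \<tau> where "\<tau> = min (r / 2) (sqrt (\<delta> / (2000 * C)))"
  have \<tau>: "\<tau> > 0" "\<tau> < r" using r(1) \<delta> C by (auto simp: \<tau>_def)
  have "\<tau>\<^sup>2 \<le> (sqrt (\<delta> / (2000 * C)))\<^sup>2" using \<tau>(1) by (intro power_mono) (auto simp: \<tau>_def)
  also have "\<dots> = \<delta> / (2000 * C)" using \<delta> C by simp
  finally have "2000 * C * \<tau>\<^sup>2 \<le> \<delta>" using C by (simp add: field_simps)
  then have \<tau>2: "1000 * C * \<tau>\<^sup>2 < \<delta>" using C \<tau>(1) \<delta> by linarith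
  define l1 where "l1 = ?l0 + \<i> * complex_of_real \<tau>"
  have l1: "cmod (l1 - ?l0) = \<tau>" using \<tau> by (simp add: l1_def norm_mult)
  have "l1 \<in> U" using r(2) \<tau>(2) l1 by (auto simp: dist_norm norm_minus_commute)
  moreover have "l1 \<notin> \<real>" using \<tau>(1) by (simp add: complex_is_Real_iff l1_def)
  ultimately have "l1 \<in> resolvent_set D A" using U(3) by blast
  then have bij: "bij_betw (\<lambda>x. A x - l1 *\<^sub>C x) D UNIV" and bl: "bounded_linear (resolvent D A l1)"
    by (auto simp: resolvent_set_def)
  define R where "R = resolvent D A l1"
  have R: "bounded_linear R" using bl by (simp add: R_def)
  have R_mem: "R y \<in> D" for y
    using bij inv_into_into[of y "\<lambda>x. A x - l1 *\<^sub>C x" D] by (simp add: R_def resolvent_def bij_betw_def)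
  have R_right': "A (R y) - l1 *\<^sub>C R y = y" for y
    using bij_betw_inv_into_right[OF bij, of y] by (simp add: R_def resolvent_def)
  then have R_right: "A (R y) = y + l1 *\<^sub>C R y" for y by (metis diff_eq_eq)
  have R_left: "R (A x - l1 *\<^sub>C x) = x" if "x \<in> D" for x
    using bij_betw_inv_into_left[OF bij that] by (simp add: R_def resolvent_def)
  have D: "cvs.subspace D" and A_scaleC: "\<And>c x. x \<in> D \<Longrightarrow> A (c *\<^sub>C x) = c *\<^sub>C A x"
    using A by (auto simp: linear_operator_def)
  have R_scaleC: "R (c *\<^sub>C y) = c *\<^sub>C R y" for c y
  proof -
    have "A (c *\<^sub>C R y) - l1 *\<^sub>C (c *\<^sub>C R y) = c *\<^sub>C (A (R y) - l1 *\<^sub>C R y)"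
      by (simp add: A_scaleC[OF R_mem] cvs.scale_right_diff_distrib scaleC_scaleC mult.commute)
    then show ?thesis
      using R_left[OF cvs.subspace_scale[OF D R_mem[of y]], of c] by (simp add: R_right')
  qed
  \<comment> \<open>\<open>L\<close>, and with it the preimage, need not be closed. In terms of
    \<open>p\<close> the inequality contains bounded operators only, so it extends to the
    closure.\<close>
  define V where "V = closure (R -` L)"
  have "cvs.subspace (R -` L)"
    using cvs.subspace_0[OF L(1)] cvs.subspace_add[OF L(1)] cvs.subspace_scale[OF L(1)]
    by (auto simp: cvs.subspace_def linear_simps[OF R] R_scaleC)
  then have V: "cvs.subspace V" unfolding V_def by (rule subspace_closure)
  have "finite_codim (R -` L)"
    by (rule finite_codim_vimage[OF _ R_scaleC L]) (rule linear_simps(1)[OF R])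
  then have V_codim: "finite_codim V" unfolding V_def by (rule finite_codim_mono) (rule closure_subset)
  have V_pos: "\<delta> * (norm (R p))\<^sup>2 \<le> Re (Ginner G (R p) (R p)) + C * (norm (p + (l1 - ?l0) *\<^sub>C R p))\<^sup>2"
    if "p \<in> V" for p
  proof -
    let ?E = "{p. \<delta> * (norm (R p))\<^sup>2 \<le> Re (Ginner G (R p) (R p)) + C * (norm (p + (l1 - ?l0) *\<^sub>C R p))\<^sup>2}"
    have contR: "continuous_on UNIV R" using linear_continuous_on[OF R] .
    have "closed ?E"
      by (intro closed_Collect_le continuous_intros contR Gi.continuous_on
          bounded_bilinear.continuous_on[OF bounded_bilinear_scaleC])
    moreover have "R -` L \<subseteq> ?E"
    proof
      fix p assume "p \<in> R -` L"
      moreover have "A (R p) - ?l0 *\<^sub>C R p = p + (l1 - ?l0) *\<^sub>C R p"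
        by (simp add: R_right cvs.scale_left_diff_distrib)
      ultimately show "p \<in> ?E" using ineq[OF R_mem, of p] by simp
    qed
    ultimately have "V \<subseteq> ?E" unfolding V_def by (rule closure_minimal[rotated])
    then show ?thesis using that by blast
  qed
  interpret positive_type_point G A R D V ?l0 l1 \<delta> C
  proof (rule positive_type_point.intro)
    show "l1 \<noteq> ?l0" using l1 \<tau>(1) by auto
    show "1000 * C * (cmod (l1 - ?l0))\<^sup>2 < \<delta>" using \<tau>2 l1 by simp
    show "closed V" by (simp add: V_def)
  qed (use G A sym R R_scaleC R_mem R_right R_left V V_codim \<delta> C V_pos in simp_all)
  show ?thesis by (rule local_estimate)
qed

section \<open>Gluing the local estimates over the interval, and the change of sign\<close>

lemma resolvent_growth_positive_type:
  assumes G: "bounded_selfadjoint G" and A: "linear_operator D A" and sym: "G_symmetric G D A"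
    and U: "open U" "complex_of_real ` {a..b} \<subseteq> U" "U - \<real> \<subseteq> resolvent_set D A"
    and pos: "complex_of_real ` {a..b} \<inter> sigma_ap D A \<subseteq> sigma_pi_plus G D A"
  shows "\<exists>V M (m::nat). open V \<and> complex_of_real ` {a..b} \<subseteq> V \<and> M > 0 \<and>
           (\<forall>l \<in> V - \<real>. l \<in> resolvent_set D A \<and>
              onorm (resolvent D A l) \<le> M / \<bar>Im l\<bar> ^ m)"
proof -
  have "\<exists>r>0. r \<le> 1 \<and> (\<exists>M>0. \<exists>m. \<forall>l. Im l \<noteq> 0 \<longrightarrow> cmod (l - complex_of_real t) < r \<longrightarrow>
     (\<forall>u\<in>D. \<bar>Im l\<bar> ^ m * norm u \<le> M * norm (A u - l *\<^sub>C u)))" if t: "t \<in> {a..b}" for t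
  proof -
    have tU: "complex_of_real t \<in> U" using U(2) t by blast
    show ?thesis
    proof (cases "complex_of_real t \<in> sigma_ap D A")
      case True
      then have "complex_of_real t \<in> sigma_pi_plus G D A" using pos t by blast
      then obtain L where L: "cvs.subspace L" "finite_codim L"
        "\<forall>x. approx_eigenseq D A (complex_of_real t) x \<and> (\<forall>n. x n \<in> L) \<longrightarrow>
            liminf (\<lambda>n. ereal (Re (Ginner G (x n) (x n)))) > 0"
        unfolding sigma_pi_plus_def by blast
      show ?thesis by (rule local_growth[OF G A sym U(1) tU U(3) L(1,2)]) (use L(3) in blast)
    next
      case False
      \<comment> \<open>Outside the approximate point spectrum there are no approximate
        eigensequences, so the whole space satisfies the positivity condition vacuously.\<close>
      have "finite_codim (UNIV :: 'a set)"
        unfolding finite_codim_def by (intro exI[of _ "{}"]) auto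
      then show ?thesis
        by (intro local_growth[OF G A sym U(1) tU U(3) cvs.subspace_UNIV])
          (use False in \<open>auto simp: sigma_ap_def\<close>)
    qed
  qed
  then obtain r M m where r: "\<And>t. t \<in> {a..b} \<Longrightarrow> r t > 0" "\<And>t. t \<in> {a..b} \<Longrightarrow> r t \<le> 1"
    and M: "\<And>t. t \<in> {a..b} \<Longrightarrow> M t > (0 :: real)"
    and est: "\<And>t l u. \<lbrakk>t \<in> {a..b}; Im l \<noteq> 0; cmod (l - complex_of_real t) < r t; u \<in> D\<rbrakk> \<Longrightarrow>
        \<bar>Im l\<bar> ^ m t * norm u \<le> M t * norm (A u - l *\<^sub>C u)"
    by metis
  have compact: "compact (complex_of_real ` {a..b})"
    by (intro compact_continuous_image continuous_intros compact_Icc)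
  have cover: "complex_of_real ` {a..b} \<subseteq> (\<Union>t\<in>{a..b}. ball (complex_of_real t) (r t))"
    using r(1) by fastforce
  obtain T where T: "T \<subseteq> {a..b}" "finite T"
    "complex_of_real ` {a..b} \<subseteq> (\<Union>t\<in>T. ball (complex_of_real t) (r t))"
    by (rule compactE_image[OF compact open_ball cover]) blast
  define V where "V = U \<inter> (\<Union>t\<in>T. ball (complex_of_real t) (r t))"
  \<comment> \<open>Sums bound each of the finitely many constants and exponents. Enlarging the
    exponent is harmless because all radii are at most 1, so that
    \<open>\<bar>Im l\<bar> \<le> 1\<close>.\<close>
  define M0 where "M0 = 1 + sum M T"
  define m0 where "m0 = sum m T"
  have M_nonneg: "\<And>t. t \<in> T \<Longrightarrow> 0 \<le> M t" using M T(1) by (meson less_imp_le subsetD)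
  have M0: "M0 > 0" unfolding M0_def using sum_nonneg[of T M, OF M_nonneg] by linarith
  have "l \<in> resolvent_set D A \<and> onorm (resolvent D A l) \<le> M0 / \<bar>Im l\<bar> ^ m0" if l: "l \<in> V - \<real>" for l
  proof -
    obtain t where t: "t \<in> T" "cmod (l - complex_of_real t) < r t"
      using l by (auto simp: V_def dist_norm norm_minus_commute)
    have tab: "t \<in> {a..b}" using t(1) T(1) by blast
    have Im: "Im l \<noteq> 0" using l by (simp add: complex_is_Real_iff)
    have Im1: "\<bar>Im l\<bar> \<le> 1"
      using abs_Im_le_cmod[of "l - complex_of_real t"] t(2) r(2)[OF tab] by simp
    have res: "l \<in> resolvent_set D A" using l U(3) by (auto simp: V_def)
    then have bij: "bij_betw (\<lambda>x. A x - l *\<^sub>C x) D UNIV" by (simp add: resolvent_set_def)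
    have "norm (resolvent D A l y) \<le> M0 / \<bar>Im l\<bar> ^ m0 * norm y" for y
    proof -
      let ?u = "resolvent D A l y"
      have u: "?u \<in> D" "A ?u - l *\<^sub>C ?u = y"
        using bij inv_into_into[of y "\<lambda>x. A x - l *\<^sub>C x" D] bij_betw_inv_into_right[OF bij, of y]
        by (simp_all add: resolvent_def bij_betw_def)
      have "\<bar>Im l\<bar> ^ m0 * norm ?u \<le> \<bar>Im l\<bar> ^ m t * norm ?u"
        using Im1 member_le_sum[OF t(1), of m] T(2) unfolding m0_def
        by (intro mult_right_mono power_decreasing) auto
      also have "\<dots> \<le> M t * norm y" using est[OF tab Im t(2) u(1)] by (simp add: u(2))
      also have "\<dots> \<le> M0 * norm y"
        using member_le_sum[OF t(1), of M] M_nonneg T(2) unfolding M0_def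
        by (intro mult_right_mono) (auto intro: add_increasing)
      finally show ?thesis using Im by (simp add: field_simps)
    qed
    then have "onorm (resolvent D A l) \<le> M0 / \<bar>Im l\<bar> ^ m0"
      by (rule onorm_bound[rotated]) (use M0 in simp)
    then show ?thesis using res by blast
  qed
  moreover have "open V" using U(1) by (simp add: V_def open_Int open_UN)
  moreover have "complex_of_real ` {a..b} \<subseteq> V" using U(2) T(3) by (simp add: V_def)
  ultimately show ?thesis using M0 by blast
qed

lemma bounded_selfadjoint_uminus: "bounded_selfadjoint G \<Longrightarrow> bounded_selfadjoint (\<lambda>x. - G x)"
  unfolding bounded_selfadjoint_def
  by (simp add: bounded_linear_minus cinner_minus_left cinner_minus_right)

lemma Ginner_uminus: "Ginner (\<lambda>x. - G x) x y = - Ginner G x y"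
  by (simp add: Ginner_def cinner_minus_left)

lemma sigma_pi_minus_uminus: "sigma_pi_minus G D A = sigma_pi_plus (\<lambda>x. - G x) D A"
proof -
  have "liminf (\<lambda>n. ereal (Re (Ginner (\<lambda>x. - G x) (x n) (x n)))) =
      - limsup (\<lambda>n. ereal (Re (Ginner G (x n) (x n))))" for x :: "nat \<Rightarrow> 'a"
    by (simp add: Ginner_uminus ereal_Liminf_uminus flip: uminus_ereal.simps)
  then show ?thesis by (simp add: sigma_pi_minus_def sigma_pi_plus_def)
qed

theorem theorem4p7:
  fixes G A :: "'a::chilbert_space \<Rightarrow> 'a"
    and D :: "'a set"
    and a b :: real
    and U :: "complex set"
  assumes "bounded_selfadjoint G"
    and "closed_operator D A"
    and "densely_defined D"
    and "G_symmetric G D A"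
    and "a \<le> b"
    and "complex_of_real ` {a..b} \<inter> sigma_ap D A \<subseteq> sigma_pi_plus G D A \<or>
         complex_of_real ` {a..b} \<inter> sigma_ap D A \<subseteq> sigma_pi_minus G D A"
    and "open U"
    and "complex_of_real ` {a..b} \<subseteq> U"
    and "U - \<real> \<subseteq> resolvent_set D A"
  shows "\<exists>V M (m::nat). open V \<and> complex_of_real ` {a..b} \<subseteq> V \<and> M > 0 \<and>
           (\<forall>l \<in> V - \<real>. l \<in> resolvent_set D A \<and>
              onorm (resolvent D A l) \<le> M / \<bar>Im l\<bar> ^ m)"
proof -
  have A: "linear_operator D A" using assms(2) by (simp add: closed_operator_def)
  from assms(6) show ?thesis
  proof
    assume "complex_of_real ` {a..b} \<inter> sigma_ap D A \<subseteq> sigma_pi_plus G D A"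
    then show ?thesis by (rule resolvent_growth_positive_type[OF assms(1) A assms(4,7-9)])
  next
    assume "complex_of_real ` {a..b} \<inter> sigma_ap D A \<subseteq> sigma_pi_minus G D A"
    moreover have "G_symmetric (\<lambda>x. - G x) D A"
      using assms(4) by (simp add: G_symmetric_def Ginner_uminus)
    ultimately show ?thesis
      unfolding sigma_pi_minus_uminus
      using resolvent_growth_positive_type[OF bounded_selfadjoint_uminus[OF assms(1)] A _ assms(7-9)] by blast
  qed
qed

end
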